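(* Let $\bar{\mathbf{Z}}^{(n)}(\cdot)=(\bar Z_Q^{(n)}(\cdot),\bar Z_{RD}^{(n)}(\cdot),\bar Z_{RC}^{(n)}(\cdot))^T$, $n\ge 1$, be the fluid scaled processes of the sequence of call center models described in the context. Let $z_Q(0),z_{RD}(0),z_{RC}(0)$ be given deterministic values and assume that $$\left(\bar Z_Q^{(n)}(0),\bar Z_{RD}^{(n)}(0),\bar Z_{RC}^{(n)}(0)\right)\xrightarrow{d}\left(z_Q(0),z_{RD}(0),z_{RC}(0)\right)\quad\text{as } n\to\infty .$$ Then the system of equations, for $t\ge 0$, \begin{align*} z_Q(t)&=z_Q(0)+\lambda t+\delta_{RD}\int_0^t z_{RD}(u)\,du+\delta_{RC}\int_0^t z_{RC}(u)\,du-\mu\int_0^t\min\{s,z_Q(u)\}\,du-\theta\int_0^t (z_Q(u)-s)^+\,du,\\ z_{RD}(t)&=z_{RD}(0)+p\theta\int_0^t (z_Q(u)-s)^+\,du-\delta_{RD}\int_0^t z_{RD}(u)\,du,\\ z_{RC}(t)&=z_{RC}(0)+q\mu\int_0^t\min\{s,z_Q(u)\}\,du-\delta_{RC}\int_0^t z_{RC}(u)\,du \end{align*} has a unique solution $\mathbf{z}(\cdot)=(z_Q(\cdot),z_{RD}(\cdot),z_{RC}(\cdot))^T$ (among continuous functions $[0,\infty)\to\mathbb{R}^3$), and the fluid limit of the stochastic model exists and equals this solution, i.e. $\bar{\mathbf{Z}}^{(n)}(\cdot)\xrightarrow{d}\mathbf{z}(\cdot)$ in $D([0,\infty),\mathbb{R}^3)$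 as $n\to\infty$.
   Context: Parameters: $\lambda,\mu,\theta,\delta_{RD},\delta_{RC}>0$, $p,q\in[0,1]$, and a positive integer $s$, all fixed. Write $x^+=\max\{x,0\}$. Model (informally): fresh calls arrive according to a Poisson process of rate $\lambda$ to a first-come-first-served queue with $s$ agents and an infinite buffer. Service times are exponential with rate $\mu$, and each waiting customer abandons after an exponential time with rate $\theta$. An abandoned customer enters the redial orbit with probability $p$ (otherwise leaves) and calls again after an exponential time with rate $\delta_{RD}$. A served customer enters the reconnect orbit with probability $q$ (otherwise leaves) and calls again after an exponential time with rate $\delta_{RC}$. $Z_Q(t)$ is the number of customers in queue plus in service, $Z_{RD}(t)$ the number in the redial orbit, and $Z_{RC}(t)$ the number in the reconnect orbit at time $t$. The $n$-th model ($n\ge1$) is the same model with fresh arrival rate $\lambda n$ and $ns$ agents, all other parameters unchanged. Formally, let $\Pi^{(n)}_{\lambda n}(\cdot)$ be a Poisson process of rate $\lambda n$, let $\Pi_1,\dots,\Pi_4$ be Poisson processes of rate $1$, and let $(B_j(p))_{j\ge1}$, $(B_j(q))_{j\ge 1}$ be two sequences of i.i.d. Bernoulli random variables with success probabilities $p$ and $q$ respectively, all these objects being independent. The process $\mathbf{Z}^{(n)}=(Z_Q^{(n)},Z_{RD}^{(n)},Z_{RC}^{(n)})^T$ has values in $\mathbb{Z}_+^3$, has right-continuous paths with left limits, starts from a random initial state $\mathbf{Z}^{(n)}(0)\in\mathbb{Z}_+^3$, and satisfies \begin{align*} Z_Q^{(n)}(t)&=Z_Q^{(n)}(0)+\Pi^{(n)}_{\lambda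 n}(t)+D_{RD}^{(n)}(t)+D_{RC}^{(n)}(t)-D_s^{(n)}(t)-D_a^{(n)}(t),\\ Z_{RD}^{(n)}(t)&=Z_{RD}^{(n)}(0)+\sum_{j=1}^{D_a^{(n)}(t)}B_j(p)-D_{RD}^{(n)}(t),\\ Z_{RC}^{(n)}(t)&=Z_{RC}^{(n)}(0)+\sum_{j=1}^{D_s^{(n)}(t)}B_j(q)-D_{RC}^{(n)}(t), \end{align*} where \begin{align*} D_s^{(n)}(t)&=\Pi_1\Big(\int_0^t\mu\min\{ns,Z_Q^{(n)}(u)\}\,du\Big),& D_a^{(n)}(t)&=\Pi_2\Big(\int_0^t\theta\,(Z_Q^{(n)}(u)-ns)^+\,du\Big),\\ D_{RD}^{(n)}(t)&=\Pi_3\Big(\int_0^t\delta_{RD}Z_{RD}^{(n)}(u)\,du\Big),& D_{RC}^{(n)}(t)&=\Pi_4\Big(\int_0^t\delta_{RC}Z_{RC}^{(n)}(u)\,du\Big). \end{align*} Fluid scaled process: $\bar{\mathbf{Z}}^{(n)}(t)=\mathbf{Z}^{(n)}(t)/n$ (componentwise). $D([0,\infty),\mathbb{R}^3)$ is the space of right-continuous functions $[0,\infty)\to\mathbb{R}^3$ with left limits, with the Skorokhod $J_1$ topology; $\xrightarrow{d}$ denotes weak convergence (convergence in distribution). If $\bar{\mathbf{Z}}^{(n)}(\cdot)\xrightarrow{d}\mathbf{z}(\cdot)$, then $\mathbf{z}(\cdot)$ is called the fluid limit of the stochastic model. *)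

theory Defs
  imports "HOL-Probability.Probability"
begin

section \<open>The space of cadlag paths with the J1 topology\<close>

definition cadlag :: "(real \<Rightarrow> 'b::topological_space) \<Rightarrow> bool" where
  "cadlag x \<longleftrightarrow>
     (\<forall>t\<ge>0. continuous (at_right t) x) \<and>
     (\<forall>t>0. \<exists>l. (x \<longlongrightarrow> l) (at_left t))"

text \<open>Paths live on \<open>[0,\<infinity>)\<close>; they are represented by functions on the reals that are
  \<^const>\<open>undefined\<close> at negative times, so that equality of functions is equality of paths.\<close>

definition cadlag_paths :: "(real \<Rightarrow> 'b::topological_space) set" where
  "cadlag_paths = {x \<in> extensional {0..}. cadlag x}"

text \<open>A strictly increasing map of \<open>[0,\<infinity>)\<close> onto itself is automatically continuous and
  vanishes at \<open>0\<close>.\<close>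

definition time_changes :: "(real \<Rightarrow> real) set" where
  "time_changes = {l. strict_mono_on {0..} l \<and> l ` {0..} = {0..}}"

text \<open>On \<open>[0,\<infinity>)\<close> the J1 topology is metrizable, and \<open>x\<^sub>n\<close> tends to \<open>x\<close> iff there are time
  changes \<open>l\<^sub>n\<close> such that \<open>l\<^sub>n - id\<close> tends to \<open>0\<close> uniformly on \<open>[0,\<infinity>)\<close> and
  \<open>x\<^sub>n \<circ> l\<^sub>n - x\<close> tends to \<open>0\<close> uniformly on every \<open>[0,T]\<close>
  (Jacod and Shiryaev, Limit Theorems for Stochastic Processes, Theorem VI.1.14).
  Equivalently, \<open>x\<^sub>n\<close> is eventually in each of the following sets. A set is therefore J1-open
  (that is, sequentially open) iff it contains such a set around each of its points.\<close>

definition J1_nbhd :: "(real \<Rightarrow> 'b::real_normed_vector) \<Rightarrow> real \<Rightarrow> real \<Rightarrow> (real \<Rightarrow> 'b) set" where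
  "J1_nbhd x T e =
     {y \<in> cadlag_paths. \<exists>l\<in>time_changes.
        (\<forall>t\<ge>0. \<bar>l t - t\<bar> \<le> e) \<and> (\<forall>t\<in>{0..T}. norm (y (l t) - x t) \<le> e)}"

definition J1_topology :: "(real \<Rightarrow> 'b::real_normed_vector) topology" where
  "J1_topology = topology (\<lambda>U. U \<subseteq> cadlag_paths \<and> (\<forall>x\<in>U. \<exists>T>0. \<exists>e>0. J1_nbhd x T e \<subseteq> U))"

lemma J1_nbhd_mono: "T \<le> T' \<Longrightarrow> e' \<le> e \<Longrightarrow> J1_nbhd x T' e' \<subseteq> J1_nbhd x T e"
  unfolding J1_nbhd_def by (auto intro!: bexI dest: order_trans[of _ e' e])

lemma openin_J1_topology:
  "openin J1_topology U \<longleftrightarrow> U \<subseteq> cadlag_paths \<and> (\<forall>x\<in>U. \<exists>T>0. \<exists>e>0. J1_nbhd x T e \<subseteq> U)"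
proof -
  have "istopology (\<lambda>U. U \<subseteq> cadlag_paths \<and>
      (\<forall>x\<in>U. \<exists>T>0. \<exists>e>0. J1_nbhd (x :: real \<Rightarrow> 'a) T e \<subseteq> U))" (is "istopology ?P")
    unfolding istopology_def
  proof (intro conjI allI impI)
    fix S S' assume S: "?P S" and S': "?P S'"
    show "S \<inter> S' \<subseteq> cadlag_paths" using S by blast
    show "\<forall>x\<in>S \<inter> S'. \<exists>T>0. \<exists>e>0. J1_nbhd x T e \<subseteq> S \<inter> S'"
    proof
      fix x assume x: "x \<in> S \<inter> S'"
      obtain T e where 1: "T > 0" "e > 0" "J1_nbhd x T e \<subseteq> S" using S x by blast
      obtain T' e' where 2: "T' > 0" "e' > 0" "J1_nbhd x T' e' \<subseteq> S'" using S' x by blast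
      have "J1_nbhd x (max T T') (min e e') \<subseteq> J1_nbhd x T e"
           "J1_nbhd x (max T T') (min e e') \<subseteq> J1_nbhd x T' e'"
        by (rule J1_nbhd_mono; simp)+
      hence "J1_nbhd x (max T T') (min e e') \<subseteq> S \<inter> S'" using 1 2 by blast
      moreover have "max T T' > 0" "min e e' > 0" using 1 2 by auto
      ultimately show "\<exists>T>0. \<exists>e>0. J1_nbhd x T e \<subseteq> S \<inter> S'" by blast
    qed
  next
    fix K assume K: "\<forall>S\<in>K. ?P S"
    show "\<Union>K \<subseteq> cadlag_paths" using K by blast
    show "\<forall>x\<in>\<Union>K. \<exists>T>0. \<exists>e>0. J1_nbhd x T e \<subseteq> \<Union>K"
    proof
      fix x assume "x \<in> \<Union>K"
      then obtain S where S: "S \<in> K" "x \<in> S" by blast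
      with K obtain T e where "T > 0" "e > 0" "J1_nbhd x T e \<subseteq> S" by metis
      thus "\<exists>T>0. \<exists>e>0. J1_nbhd x T e \<subseteq> \<Union>K"
        using S by (meson Union_upper order_trans)
    qed
  qed
  thus ?thesis by (simp add: J1_topology_def)
qed

lemma topspace_J1_topology: "topspace J1_topology = cadlag_paths"
proof (rule antisym)
  show "topspace J1_topology \<subseteq> cadlag_paths"
    using openin_topspace openin_J1_topology by blast
  have "openin J1_topology cadlag_paths"
    unfolding openin_J1_topology J1_nbhd_def by (auto intro!: exI[of _ 1])
  thus "cadlag_paths \<subseteq> topspace J1_topology" by (rule openin_subset)
qed


section \<open>Convergence in distribution\<close>

definition borel_of :: "'b topology \<Rightarrow> 'b measure" where
  "borel_of T = sigma (topspace T) {U. openin T U}"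

text \<open>Sequences are indexed by \<open>n \<ge> 1\<close>, and each \<open>X n\<close> may live on its own probability space
  \<open>M n\<close>. The limit is given by its law \<open>L\<close>.\<close>

definition converges_in_distribution ::
  "'b topology \<Rightarrow> (nat \<Rightarrow> 'a measure) \<Rightarrow> (nat \<Rightarrow> 'a \<Rightarrow> 'b) \<Rightarrow> 'b measure \<Rightarrow> bool" where
  "converges_in_distribution T M X L \<longleftrightarrow>
     (\<forall>n\<ge>1. X n \<in> measurable (M n) (borel_of T)) \<and>
     (\<forall>f. continuous_map T euclideanreal f \<and> bounded (f ` topspace T) \<longrightarrow>
        (\<lambda>n. \<integral>\<omega>. f (X n \<omega>) \<partial>M n) \<longlonglongrightarrow> (\<integral>x. f x \<partial>L))"


section \<open>The stochastic primitives\<close>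

definition poisson_process :: "'a measure \<Rightarrow> real \<Rightarrow> (real \<Rightarrow> 'a \<Rightarrow> nat) \<Rightarrow> bool" where
  "poisson_process M r N \<longleftrightarrow>
     (\<forall>t\<ge>0. N t \<in> measurable M (count_space UNIV)) \<and>
     (\<forall>\<omega>\<in>space M. N 0 \<omega> = 0 \<and> mono_on {0..} (\<lambda>t. N t \<omega>) \<and>
        (\<forall>t\<ge>0. continuous (at_right t) (\<lambda>u. N u \<omega>))) \<and>
     (\<forall>a b. 0 \<le> a \<and> a < b \<longrightarrow>
        distr M (count_space UNIV) (\<lambda>\<omega>. N b \<omega> - N a \<omega>) = measure_pmf (poisson_pmf (r * (b - a)))) \<and>
     (\<forall>\<tau> k. 0 \<le> \<tau> 0 \<and> mono \<tau> \<longrightarrow>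
        prob_space.indep_vars M (\<lambda>_. count_space UNIV)
          (\<lambda>i \<omega>. N (\<tau> (Suc i)) \<omega> - N (\<tau> i) \<omega>) {..<k::nat})"

definition iid_bernoulli :: "'a measure \<Rightarrow> real \<Rightarrow> (nat \<Rightarrow> 'a \<Rightarrow> bool) \<Rightarrow> bool" where
  "iid_bernoulli M r B \<longleftrightarrow>
     prob_space.indep_vars M (\<lambda>_. count_space UNIV) B {1..} \<and>
     (\<forall>j\<ge>1. distr M (count_space UNIV) (B j) = measure_pmf (bernoulli_pmf r))"

text \<open>The sigma-algebra generated by a family \<open>X\<close> of discrete random variables.\<close>

definition family_events :: "'a measure \<Rightarrow> 'i set \<Rightarrow> ('i \<Rightarrow> 'a \<Rightarrow> 'c) \<Rightarrow> 'a set set" where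
  "family_events M I X = sigma_sets (space M) (\<Union>i\<in>I. {X i -` A \<inter> space M | A. A \<in> UNIV})"


section \<open>The call center model with redials and reconnects\<close>

text \<open>The \<open>n\<close>-th model: \<open>P\<^sub>0\<close> counts the fresh calls, \<open>P\<^sub>1, \<dots>, P\<^sub>4\<close> drive the service completions,
  the abandonments, the redials and the reconnects, and \<open>Bp\<close>, \<open>Bq\<close> decide who enters the two
  orbits. No relation between the initial state and these objects is imposed.\<close>

locale call_center_data = prob_space M for M :: "'a measure" +
  fixes lam mu theta dRD dRC p q :: real and s n :: nat
    and P\<^sub>0 P\<^sub>1 P\<^sub>2 P\<^sub>3 P\<^sub>4 :: "real \<Rightarrow> 'a \<Rightarrow> nat"
    and Bp Bq :: "nat \<Rightarrow> 'a \<Rightarrow> bool"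
    and ZQ ZRD ZRC :: "real \<Rightarrow> 'a \<Rightarrow> nat"
begin

definition Ds :: "real \<Rightarrow> 'a \<Rightarrow> nat" where
  "Ds t \<omega> = P\<^sub>1 (integral {0..t} (\<lambda>u. mu * min (real (n * s)) (real (ZQ u \<omega>)))) \<omega>"

definition Da :: "real \<Rightarrow> 'a \<Rightarrow> nat" where
  "Da t \<omega> = P\<^sub>2 (integral {0..t} (\<lambda>u. theta * max (real (ZQ u \<omega>) - real (n * s)) 0)) \<omega>"

definition DRD :: "real \<Rightarrow> 'a \<Rightarrow> nat" where
  "DRD t \<omega> = P\<^sub>3 (integral {0..t} (\<lambda>u. dRD * real (ZRD u \<omega>))) \<omega>"

definition DRC :: "real \<Rightarrow> 'a \<Rightarrow> nat" where
  "DRC t \<omega> = P\<^sub>4 (integral {0..t} (\<lambda>u. dRC * real (ZRC u \<omega>))) \<omega>"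

end

locale call_center_model = call_center_data +
  assumes fresh: "poisson_process M (lam * real n) P\<^sub>0"
    and unit_rate: "poisson_process M 1 P\<^sub>1" "poisson_process M 1 P\<^sub>2"
      "poisson_process M 1 P\<^sub>3" "poisson_process M 1 P\<^sub>4"
    and bernoulli: "iid_bernoulli M p Bp" "iid_bernoulli M q Bq"
    and independent: "indep_sets
      (\<lambda>i. [family_events M {0..} P\<^sub>0, family_events M {0..} P\<^sub>1, family_events M {0..} P\<^sub>2,
            family_events M {0..} P\<^sub>3, family_events M {0..} P\<^sub>4,
            family_events M {1..} Bp, family_events M {1..} Bq] ! i) {..<7}"
    and random_variables: "\<And>t. t \<ge> 0 \<Longrightarrow> ZQ t \<in> measurable M (count_space UNIV)"
      "\<And>t. t \<ge> 0 \<Longrightarrow> ZRD t \<in> measurable M (count_space UNIV)"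
      "\<And>t. t \<ge> 0 \<Longrightarrow> ZRC t \<in> measurable M (count_space UNIV)"
    and paths: "\<And>\<omega>. \<omega> \<in> space M \<Longrightarrow> cadlag (\<lambda>t. ZQ t \<omega>)"
      "\<And>\<omega>. \<omega> \<in> space M \<Longrightarrow> cadlag (\<lambda>t. ZRD t \<omega>)"
      "\<And>\<omega>. \<omega> \<in> space M \<Longrightarrow> cadlag (\<lambda>t. ZRC t \<omega>)"
    and dynamics: "AE \<omega> in M. \<forall>t\<ge>0.
        real (ZQ t \<omega>) = real (ZQ 0 \<omega>) + real (P\<^sub>0 t \<omega>) + real (DRD t \<omega>) + real (DRC t \<omega>)
          - real (Ds t \<omega>) - real (Da t \<omega>) \<and>
        real (ZRD t \<omega>) = real (ZRD 0 \<omega>) + (\<Sum>j=1..Da t \<omega>. of_bool (Bp j \<omega>)) - real (DRD t \<omega>) \<and>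
        real (ZRC t \<omega>) = real (ZRC 0 \<omega>) + (\<Sum>j=1..Ds t \<omega>. of_bool (Bq j \<omega>)) - real (DRC t \<omega>)"

definition fluid_scaled ::
  "nat \<Rightarrow> (real \<Rightarrow> 'a \<Rightarrow> nat) \<Rightarrow> (real \<Rightarrow> 'a \<Rightarrow> nat) \<Rightarrow> (real \<Rightarrow> 'a \<Rightarrow> nat) \<Rightarrow> real \<Rightarrow> 'a \<Rightarrow> real^3" where
  "fluid_scaled n ZQ ZRD ZRC t \<omega> =
     vector [real (ZQ t \<omega>) / real n, real (ZRD t \<omega>) / real n, real (ZRC t \<omega>) / real n]"


section \<open>The fluid equations\<close>

text \<open>The components \<open>1\<close>, \<open>2\<close>, \<open>3\<close> are those of the queue, the redial orbit and the reconnect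
  orbit.\<close>

definition fluid_solution ::
  "real \<Rightarrow> real \<Rightarrow> real \<Rightarrow> real \<Rightarrow> real \<Rightarrow> real \<Rightarrow> real \<Rightarrow> nat \<Rightarrow> real^3 \<Rightarrow> (real \<Rightarrow> real^3) \<Rightarrow> bool" where
  "fluid_solution lam mu theta dRD dRC p q s z\<^sub>0 z \<longleftrightarrow>
     z \<in> extensional {0..} \<and> continuous_on {0..} z \<and>
     (\<forall>t\<ge>0.
        z t $ 1 = z\<^sub>0 $ 1 + lam * t + dRD * integral {0..t} (\<lambda>u. z u $ 2)
          + dRC * integral {0..t} (\<lambda>u. z u $ 3)
          - mu * integral {0..t} (\<lambda>u. min (real s) (z u $ 1))
          - theta * integral {0..t} (\<lambda>u. max (z u $ 1 - real s) 0) \<and>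
        z t $ 2 = z\<^sub>0 $ 2 + p * theta * integral {0..t} (\<lambda>u. max (z u $ 1 - real s) 0)
          - dRD * integral {0..t} (\<lambda>u. z u $ 2) \<and>
        z t $ 3 = z\<^sub>0 $ 3 + q * mu * integral {0..t} (\<lambda>u. min (real s) (z u $ 1))
          - dRC * integral {0..t} (\<lambda>u. z u $ 3))"

end

theory Submission
  imports Defs
begin

text \<open>
  The scaled process solves the fluid equations up to a residual made of the centred primitives.
  Chebyshev's inequality on a finite grid together with monotonicity makes the centred Poisson
  processes uniformly small with high probability on bounded time intervals, and Hoeffding's inequality
  does the same for the Bernoulli sums. The random times at which the primitives are read stay bounded,
  since the total number of customers is at most the initial number plus the number of fresh calls. The
  drift is Lipschitz, so Gronwall's inequality turns a small residual into uniform closeness to the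
  solution on \<open>[0,T]\<close>, which is stronger than closeness in the J1 topology. As the limit is
  deterministic, this convergence in probability gives convergence in distribution.
\<close>

subsection \<open>Cadlag paths\<close>

text \<open>Closeness in probability is not the whole claim: convergence in distribution also asks
  that the scaled paths be measurable for the Borel sets of the J1 topology. That topology is given
  by neighbourhoods and not by a metric, so its open sets are reached through paths sampled on a
  finite grid. The scaled states take countably many values, hence the event that a finite sample
  falls into an arbitrary set is measurable. The pathwise estimate is free of circularity because
  the bound on the number of customers uses only the initial state and the fresh calls: a
  deterministic range for the four other clocks is known before their fluctuations enter. No
  localisation is required afterwards, as \<open>min\<close> and the positive part are Lipschitz on
  the whole line; the same fact gives global existence and uniqueness for the fluid
  equations.\<close>

lemma cadlagD:
  assumes "cadlag x"
  shows "t \<ge> 0 \<Longrightarrow> (x \<longlongrightarrow> x t) (at_right t)"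
    and "t > 0 \<Longrightarrow> \<exists>l. (x \<longlongrightarrow> l) (at_left t)"
  using assms by (simp_all add: cadlag_def continuous_within)

text \<open>Induction along a partition on whose pieces \<open>x\<close> oscillates by at most \<open>e\<close>: the supremum of the
  times reached belongs to them by the left limit, and can be passed by right continuity.\<close>

lemma cadlag_induct:
  fixes x :: "real \<Rightarrow> 'b::metric_space"
  assumes x: "cadlag x" and e: "e > 0" and "T \<ge> 0" and P0: "P 0"
    and step: "\<And>a b. 0 \<le> a \<Longrightarrow> a < b \<Longrightarrow>
      (\<And>u v. u \<in> {a..<b} \<Longrightarrow> v \<in> {a..<b} \<Longrightarrow> dist (x u) (x v) \<le> e) \<Longrightarrow> P a \<Longrightarrow> P b"
  shows "P T"
proof -
  define S where "S = {t\<in>{0..T}. P t}"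
  define c where "c = Sup S"
  have S0: "0 \<in> S" using P0 \<open>T \<ge> 0\<close> by (simp add: S_def)
  have bdd: "bdd_above S" by (rule bdd_aboveI[of _ T]) (simp add: S_def)
  have c: "0 \<le> c" "c \<le> T"
    unfolding c_def using S0 bdd by (auto intro!: cSup_upper cSup_least simp: S_def)
  have close: "dist (x u) (x v) \<le> e" if "dist (x u) l < e/2" "dist (x v) l < e/2" for u v l
    using that dist_triangle2[of "x u" "x v" l] by linarith
  have Pc: "P c"
  proof (cases "c = 0")
    case False
    with c have "c > 0" by simp
    then obtain l where "(x \<longlongrightarrow> l) (at_left c)" using cadlagD(2)[OF x] by blast
    hence "eventually (\<lambda>u. dist (x u) l < e/2) (at_left c)"
      using e by (intro tendstoD) auto
    then obtain d where d: "d < c" "\<And>u. d < u \<Longrightarrow> u < c \<Longrightarrow> dist (x u) l < e/2"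
      unfolding eventually_at_left_field by blast
    obtain t where t: "t \<in> S" "d < t"
      using less_cSupE[OF d(1)[unfolded c_def]] S0 by blast
    have "t \<le> c" unfolding c_def using t bdd by (intro cSup_upper)
    show ?thesis
    proof (cases "t = c")
      case True thus ?thesis using t by (simp add: S_def)
    next
      case False
      with \<open>t \<le> c\<close> have "t < c" by simp
      thus ?thesis
        using t d by (intro step[of t c] close[of _ l]) (auto simp: S_def)
    qed
  qed (use P0 in simp)
  have "c = T"
  proof (rule ccontr)
    assume "c \<noteq> T"
    with c have "c < T" by simp
    have "(x \<longlongrightarrow> x c) (at_right c)" using cadlagD(1)[OF x c(1)] .
    hence "eventually (\<lambda>u. dist (x u) (x c) < e/2) (at_right c)"
      using e by (intro tendstoD) auto
    then obtain d where d: "d > c" "\<And>u. c < u \<Longrightarrow> u < d \<Longrightarrow> dist (x u) (x c) < e/2"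
      unfolding eventually_at_right_field by blast
    have near: "dist (x u) (x c) < e/2" if "c \<le> u" "u < d" for u
      using that d(2)[of u] e by (cases "u = c") auto
    have "P (min d T)"
      using c Pc d(1) \<open>c < T\<close> by (intro step[of c "min d T"] close[of _ "x c"] near) auto
    hence "min d T \<in> S" using d(1) c by (auto simp: S_def)
    hence "min d T \<le> c" unfolding c_def using bdd by (intro cSup_upper)
    thus False using d(1) \<open>c < T\<close> by auto
  qed
  with Pc show ?thesis by simp
qed

text \<open>A cadlag path is a uniform limit of step functions on \<open>{0..T}\<close>, and uniform
  limits preserve integrability. The induction carries an approximant within \<open>e\<close> across
  one more piece of the partition.\<close>

lemma cadlag_integrable:
  fixes x :: "real \<Rightarrow> 'b::banach"
  assumes "cadlag x"
  shows "x integrable_on {0..T}"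
proof (cases "T \<ge> 0")
  case True
  have "x integrable_on cbox 0 T"
  proof (rule integrable_uniform_limit)
    fix e :: real assume "e > 0"
    show "\<exists>g. (\<forall>t\<in>cbox 0 T. norm (x t - g t) \<le> e) \<and> g integrable_on cbox 0 T"
      using assms \<open>e > 0\<close> True
    proof (rule cadlag_induct)
      show "\<exists>g. (\<forall>t\<in>cbox 0 0. norm (x t - g t) \<le> e) \<and> g integrable_on cbox 0 0"
        using \<open>e > 0\<close> integrable_on_refl[of x 0] by (intro exI[of _ x]) auto
    next
      fix a b :: real
      assume ab: "0 \<le> a" "a < b"
        and osc: "\<And>u v. u \<in> {a..<b} \<Longrightarrow> v \<in> {a..<b} \<Longrightarrow> dist (x u) (x v) \<le> e"
        and "\<exists>g. (\<forall>t\<in>cbox 0 a. norm (x t - g t) \<le> e) \<and> g integrable_on cbox 0 a"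
      then obtain g where g: "\<forall>t\<in>cbox 0 a. norm (x t - g t) \<le> e" "g integrable_on cbox 0 a"
        by blast
      \<comment> \<open>The right end gets its own value \<open>x b\<close>: the oscillation is
        controlled only on the half-open piece, and \<open>x\<close> may jump at
        \<open>b\<close>.\<close>
      define h where "h t = (if t \<le> a then g t else if t < b then x a else x b)" for t
      have "h integrable_on {0..a}"
        using g(2)[unfolded cbox_interval] by (rule integrable_eq) (simp add: h_def)
      moreover have "h integrable_on {a..b}"
        using integrable_const_ivl[of "x a" a b] by (rule integrable_spike_finite[of "{a,b}", rotated 2])
          (auto simp: h_def)
      ultimately have "h integrable_on cbox 0 b"
        using ab Henstock_Kurzweil_Integration.integrable_combine[of 0 a b h] by simp
      moreover have "norm (x t - h t) \<le> e" if "t \<in> cbox 0 b" for t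
        using that ab g(1) osc[of t a] \<open>e > 0\<close> by (auto simp: h_def dist_norm)
      ultimately show "\<exists>g. (\<forall>t\<in>cbox 0 b. norm (x t - g t) \<le> e) \<and> g integrable_on cbox 0 b"
        by blast
    qed
  qed
  thus ?thesis by simp
qed (simp add: integrable_on_empty)

lemma cadlag_compose:
  fixes f :: "'b::topological_space \<Rightarrow> 'c::topological_space"
  assumes "cadlag x" "continuous_on UNIV f"
  shows "cadlag (\<lambda>t. f (x t))"
proof -
  have f: "((\<lambda>t. f (x t)) \<longlongrightarrow> f l) F" if "(x \<longlongrightarrow> l) F" for F l
    using assms(2) that by (rule continuous_on_tendsto_compose) auto
  show ?thesis
    unfolding cadlag_def continuous_within
  proof (intro conjI allI impI)
    show "((\<lambda>t. f (x t)) \<longlongrightarrow> f (x t)) (at_right t)" if "t \<ge> 0" for t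
      using cadlagD(1)[OF assms(1) that] by (rule f)
    show "\<exists>l. ((\<lambda>t. f (x t)) \<longlongrightarrow> l) (at_left t)" if t: "t > 0" for t
    proof -
      obtain l where "(x \<longlongrightarrow> l) (at_left t)"
        using cadlagD(2)[OF assms(1) t] by blast
      from f[OF this] show ?thesis ..
    qed
  qed
qed

lemma cadlag_Pair:
  assumes "cadlag x" "cadlag y"
  shows "cadlag (\<lambda>t. (x t, y t))"
  unfolding cadlag_def
proof (intro conjI allI impI)
  show "continuous (at_right t) (\<lambda>t. (x t, y t))" if "t \<ge> 0" for t
    using assms that by (auto simp: cadlag_def intro: continuous_Pair)
  show "\<exists>l. ((\<lambda>t. (x t, y t)) \<longlongrightarrow> l) (at_left t)" if t: "t > 0" for t
  proof -
    obtain l m where "(x \<longlongrightarrow> l) (at_left t)" "(y \<longlongrightarrow> m) (at_left t)"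
      using cadlagD(2)[OF assms(1) t] cadlagD(2)[OF assms(2) t] by blast
    from tendsto_Pair[OF this] show ?thesis ..
  qed
qed

text \<open>Every \<open>t > 0\<close> has a left neighbourhood inside \<open>{0..}\<close>, so
  negative times never matter. This is what allows passing to paths restricted to
  \<open>{0..}\<close>.\<close>

lemma cadlag_cong_nonneg:
  assumes "cadlag x" "\<And>t. t \<ge> 0 \<Longrightarrow> x t = y t"
  shows "cadlag y"
  unfolding cadlag_def continuous_within
proof (intro conjI allI impI)
  show "(y \<longlongrightarrow> y t) (at_right t)" if "t \<ge> 0" for t
  proof -
    have "(x \<longlongrightarrow> x t) (at_right t)" using cadlagD(1)[OF assms(1) that] .
    moreover have "eventually (\<lambda>u. x u = y u) (at_right t)"
      using that assms(2) unfolding eventually_at_right_field by (intro exI[of _ "t+1"]) auto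
    ultimately show ?thesis using assms(2) that by (auto intro: Lim_transform_eventually)
  qed
  show "\<exists>l. (y \<longlongrightarrow> l) (at_left t)" if t: "t > 0" for t
  proof -
    obtain l where "(x \<longlongrightarrow> l) (at_left t)" using cadlagD(2)[OF assms(1) t] by blast
    moreover have "eventually (\<lambda>u. x u = y u) (at_left t)"
      using t assms(2) unfolding eventually_at_left_field by (intro exI[of _ 0]) auto
    ultimately show ?thesis by (auto intro: Lim_transform_eventually)
  qed
qed

lemma continuous_on_cadlag:
  assumes "continuous_on {0..} x"
  shows "cadlag x"
  unfolding cadlag_def continuous_within
proof (intro conjI allI impI)
  show "(x \<longlongrightarrow> x t) (at_right t)" if "t \<ge> 0" for t
  proof -
    have "(x \<longlongrightarrow> x t) (at t within {0..})"
      using assms that by (auto simp: continuous_on_def)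
    thus ?thesis by (rule tendsto_within_subset) (use that in auto)
  qed
  show "\<exists>l. (x \<longlongrightarrow> l) (at_left t)" if "t > 0" for t
  proof -
    have "(x \<longlongrightarrow> x t) (at t within {0..})"
      using assms that by (auto simp: continuous_on_def)
    hence "(x \<longlongrightarrow> x t) (at t within {0<..})"
      by (rule tendsto_within_subset) auto
    hence "(x \<longlongrightarrow> x t) (at t)" using that at_within_open[of t "{0<..}"] by simp
    hence "(x \<longlongrightarrow> x t) (at_left t)" by (rule tendsto_within_subset) simp
    thus ?thesis ..
  qed
qed

subsection \<open>Measurability for the J1 topology\<close>

lemma id_time_changes: "(\<lambda>t. t) \<in> time_changes"
  by (auto simp: time_changes_def strict_mono_on_def)

lemma time_changes_nonneg: "l \<in> time_changes \<Longrightarrow> t \<ge> 0 \<Longrightarrow> l t \<ge> 0"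
  by (auto simp: time_changes_def)

lemma compose_time_changes:
  assumes l: "l \<in> time_changes" and k: "k \<in> time_changes"
  shows "(\<lambda>t. l (k t)) \<in> time_changes"
proof -
  have "l (k u) < l (k v)" if "0 \<le> u" "u < v" for u v
    using l k that time_changes_nonneg[OF k, of u] time_changes_nonneg[OF k, of v]
    by (auto simp: time_changes_def intro!: strict_mono_onD[of "{0..}" l] strict_mono_onD[of "{0..}" k])
  hence "strict_mono_on {0..} (\<lambda>t. l (k t))" by (intro strict_mono_onI) auto
  thus ?thesis
    using l k image_image[of l k "{0..}"] by (simp add: time_changes_def)
qed

lemma inverse_time_changes:
  assumes l: "l \<in> time_changes"
  shows "the_inv_into {0..} l \<in> time_changes"
    and "t \<ge> 0 \<Longrightarrow> l (the_inv_into {0..} l t) = t"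
proof -
  have inj: "inj_on l {0..}" and im: "l ` {0..} = {0..}"
    using l strict_mono_on_imp_inj_on by (auto simp: time_changes_def)
  have inv: "l (the_inv_into {0..} l t) = t" "the_inv_into {0..} l t \<ge> 0" if "t \<ge> 0" for t
    using f_the_inv_into_f[OF inj, of t] the_inv_into_into[OF inj, of t "{0..}"] im that by auto
  show "l (the_inv_into {0..} l t) = t" if "t \<ge> 0" using inv(1)[OF that] .
  have "strict_mono_on {0..} (the_inv_into {0..} l)"
  proof (rule strict_mono_onI)
    fix u v :: real assume uv: "u \<in> {0..}" "v \<in> {0..}" "u < v"
    show "the_inv_into {0..} l u < the_inv_into {0..} l v"
    proof (rule ccontr)
      assume "\<not> ?thesis"
      hence "l (the_inv_into {0..} l v) \<le> l (the_inv_into {0..} l u)"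
        using l uv inv by (intro strict_mono_on_leD[of "{0..}" l]) (auto simp: time_changes_def)
      thus False using uv inv by simp
    qed
  qed
  moreover have "the_inv_into {0..} l ` {0..} = {0..}"
    using the_inv_into_onto[OF inj] im by simp
  ultimately show "the_inv_into {0..} l \<in> time_changes" by (simp add: time_changes_def)
qed

text \<open>The time change for \<open>z\<close> is applied after the one for \<open>y\<close>. The
  latter can carry \<open>{0..T}\<close> as far as \<open>T + d\<close>, so the second closeness
  must reach that far.\<close>

lemma J1_nbhd_trans:
  assumes y: "y \<in> J1_nbhd x T d" and z: "z \<in> J1_nbhd y (T + d) e"
  shows "z \<in> J1_nbhd x T (d + e)"
proof -
  obtain l where l: "l \<in> time_changes" "\<And>t. t \<ge> 0 \<Longrightarrow> \<bar>l t - t\<bar> \<le> d"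
      "\<And>t. t \<in> {0..T} \<Longrightarrow> norm (y (l t) - x t) \<le> d"
    using y by (auto simp: J1_nbhd_def)
  obtain k where k: "k \<in> time_changes" "\<And>t. t \<ge> 0 \<Longrightarrow> \<bar>k t - t\<bar> \<le> e"
      "\<And>t. t \<in> {0..T+d} \<Longrightarrow> norm (z (k t) - y t) \<le> e"
    using z by (auto simp: J1_nbhd_def)
  have "\<bar>k (l t) - t\<bar> \<le> d + e" if "t \<ge> 0" for t
    using l(2)[OF that] k(2)[of "l t"] time_changes_nonneg[OF l(1) that] by auto
  moreover have "norm (z (k (l t)) - x t) \<le> d + e" if "t \<in> {0..T}" for t
  proof -
    have "l t \<in> {0..T+d}" using l(2)[of t] time_changes_nonneg[OF l(1), of t] that by auto
    thus ?thesis
      using k(3)[of "l t"] l(3)[OF that] norm_triangle_ineq[of "z (k (l t)) - y (l t)" "y (l t) - x t"]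
      by simp
  qed
  ultimately show ?thesis
    using z compose_time_changes[OF k(1) l(1)]
    by (auto simp: J1_nbhd_def intro!: bexI[where x = "\<lambda>t. k (l t)"])
qed

text \<open>The inverse time change is used. It can carry \<open>{0..T}\<close> as far as
  \<open>T + e\<close>, which is why symmetry costs \<open>e\<close> of the time horizon.\<close>

lemma J1_nbhd_sym:
  assumes y: "y \<in> J1_nbhd x (T + e) e" and x: "x \<in> cadlag_paths"
  shows "x \<in> J1_nbhd y T e"
proof -
  obtain l where l: "l \<in> time_changes" "\<And>t. t \<ge> 0 \<Longrightarrow> \<bar>l t - t\<bar> \<le> e"
      "\<And>t. t \<in> {0..T+e} \<Longrightarrow> norm (y (l t) - x t) \<le> e"
    using y by (auto simp: J1_nbhd_def)
  let ?k = "the_inv_into {0..} l"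
  note k = inverse_time_changes[OF l(1)]
  have near: "\<bar>?k t - t\<bar> \<le> e" if "t \<ge> 0" for t
    using l(2)[of "?k t"] k(2)[OF that] time_changes_nonneg[OF k(1) that] by (simp add: abs_minus_commute)
  moreover have "norm (x (?k t) - y t) \<le> e" if "t \<in> {0..T}" for t
    using l(3)[of "?k t"] k(2)[of t] time_changes_nonneg[OF k(1), of t] near[of t] that
    by (simp add: norm_minus_commute abs_le_iff)
  ultimately show ?thesis
    using x k(1) by (auto simp: J1_nbhd_def intro!: bexI[where x = ?k])
qed

text \<open>The cut-off at time \<open>m\<close> makes \<open>grid_path m x\<close> depend on only finitely many values of \<open>x\<close>.\<close>

definition grid_point :: "nat \<Rightarrow> real \<Rightarrow> real" where
  "grid_point m t = min (of_int \<lfloor>real m * t\<rfloor> / real m) (real m)"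

definition grid_path :: "nat \<Rightarrow> (real \<Rightarrow> 'b) \<Rightarrow> real \<Rightarrow> 'b" where
  "grid_path m x = restrict (\<lambda>t. x (grid_point m t)) {0..}"

lemma eventually_floor_right:
  "eventually (\<lambda>u. \<lfloor>u\<rfloor> = \<lfloor>t\<rfloor>) (at_right (t::real))"
  unfolding eventually_at_right_field
  by (rule exI[of _ "of_int \<lfloor>t\<rfloor> + 1"]) (auto simp: floor_eq_iff; linarith)

text \<open>Just below an integer the floor drops by one; \<open>\<lceil>t\<rceil> - 1\<close>
  describes this case and the non-integer case alike.\<close>

lemma eventually_floor_left:
  "eventually (\<lambda>u. \<lfloor>u\<rfloor> = \<lceil>t\<rceil> - 1) (at_left (t::real))"
  unfolding eventually_at_left_field
  by (rule exI[of _ "of_int \<lceil>t\<rceil> - 1"]) (auto simp: floor_eq_iff; linarith)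

text \<open>\<open>grid_point m\<close> is constant on a small interval to either side of each time,
  with the value at that time on the right side, so the one-sided limits exist whatever
  \<open>x\<close> is.\<close>

lemma grid_path_cadlag_paths:
  assumes "m > 0"
  shows "grid_path m x \<in> cadlag_paths"
proof -
  have "cadlag (\<lambda>t. x (grid_point m t))"
    unfolding cadlag_def continuous_within
  proof (intro conjI allI impI)
    fix t :: real
    have "filterlim (\<lambda>u. real m * u) (at_right (real m * t)) (at_right t)"
      unfolding filterlim_at using assms
      by (auto simp: eventually_at_filter intro!: tendsto_eq_intros)
    hence "eventually (\<lambda>u. \<lfloor>real m * u\<rfloor> = \<lfloor>real m * t\<rfloor>) (at_right t)"
      using eventually_floor_right by (auto simp: filterlim_iff)
    hence "eventually (\<lambda>u. x (grid_point m t) = x (grid_point m u)) (at_right t)"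
      by eventually_elim (simp add: grid_point_def)
    thus "((\<lambda>t. x (grid_point m t)) \<longlongrightarrow> x (grid_point m t)) (at_right t)"
      by (rule Lim_transform_eventually[OF tendsto_const])
    have "filterlim (\<lambda>u. real m * u) (at_left (real m * t)) (at_left t)"
      unfolding filterlim_at using assms
      by (auto simp: eventually_at_filter intro!: tendsto_eq_intros)
    hence "eventually (\<lambda>u. \<lfloor>real m * u\<rfloor> = \<lceil>real m * t\<rceil> - 1) (at_left t)"
      using eventually_floor_left by (auto simp: filterlim_iff)
    hence "eventually (\<lambda>u. x (min ((\<lceil>real m * t\<rceil> - 1) / real m) (real m)) = x (grid_point m u)) (at_left t)"
      by eventually_elim (simp add: grid_point_def)
    from Lim_transform_eventually[OF tendsto_const this]
    show "\<exists>l. ((\<lambda>t. x (grid_point m t)) \<longlongrightarrow> l) (at_left t)" ..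
  qed
  hence "cadlag (grid_path m x)"
    by (rule cadlag_cong_nonneg) (simp add: grid_path_def)
  thus ?thesis by (simp add: cadlag_paths_def grid_path_def)
qed

text \<open>Serves to build a time change node by node: the new piece is the line from
  \<open>(a, l a)\<close> to \<open>(b, c)\<close>, whose slope \<open>r\<close> is positive because
  both coordinates increase.\<close>

lemma time_changes_extend:
  fixes l :: "real \<Rightarrow> real"
  assumes l: "strict_mono_on {0..a} l" "l ` {0..a} = {0..l a}" and ab: "0 \<le> a" "a < b" and c: "l a < c"
  defines "k \<equiv> \<lambda>t. if t \<le> a then l t else l a + (c - l a) / (b - a) * (t - a)"
  shows "strict_mono_on {0..b} k" "k ` {0..b} = {0..k b}" "k b = c"
proof -
  define r where "r = (c - l a) / (b - a)"
  have r: "r > 0" using ab c by (simp add: r_def)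
  show kb: "k b = c" using ab by (simp add: k_def)
  have kr: "k t = l a + r * (t - a)" if "t \<ge> a" for t
    using that by (auto simp: k_def r_def)
  have kl: "k t = l t" if "t \<le> a" for t using that by (simp add: k_def)
  have mono1: "k u < k v" if "a \<le> u" "u < v" for u v
    using that r by (simp add: kr)
  have mono2: "k u < k v" if "0 \<le> u" "u < v" "v \<le> a" for u v
    using that l(1) by (simp add: kl strict_mono_on_def)
  show "strict_mono_on {0..b} k"
  proof (rule strict_mono_onI)
    fix u v assume "u \<in> {0..b}" "v \<in> {0..b}" "u < v"
    thus "k u < k v"
      using mono1[of u v] mono2[of u v] mono2[of u a] mono1[of a v] ab
      by (cases "u = a"; cases "v = a"; cases "u < a"; cases "v < a") auto
  qed
  have "k ` {0..b} = k ` {0..a} \<union> k ` {a..b}"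
    using ab by (subst image_Un[symmetric]) (simp add: ivl_disj_un_two_touch)
  also have "k ` {0..a} = {0..l a}" using l(2) image_cong[of "{0..a}" _ k l] by (simp add: kl)
  also have "k ` {a..b} = {l a..c}"
  proof -
    have "k ` {a..b} = (\<lambda>t. r * t + (l a - r * a)) ` {a..b}"
      by (rule image_cong) (auto simp: kr algebra_simps)
    also have "\<dots> = {l a..c}"
    proof -
      have "r * (b - a) = c - l a" using ab by (simp add: r_def)
      thus ?thesis using r ab by (subst image_affinity_atLeastAtMost) (auto simp: algebra_simps)
    qed
    finally show ?thesis .
  qed
  also have "{0..l a} \<union> {l a..c} = {0..c}"
  proof -
    have "0 \<le> l a" using l(2) ab by (metis atLeastAtMost_iff image_eqI order_refl)
    thus ?thesis using c by auto
  qed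
  finally show "k ` {0..b} = {0..k b}" by (simp add: kb)
qed

text \<open>The time change maps the endpoints of the pieces of the partition to the next grid point, so that
  within a piece the grid point below \<open>l t\<close> lies in the piece of \<open>t\<close>.\<close>

lemma grid_path_near:
  fixes x :: "real \<Rightarrow> 'b::real_normed_vector"
  assumes x: "cadlag x" and "e > 0" "T \<ge> 0"
  shows "eventually (\<lambda>m. \<exists>l. strict_mono_on {0..T} l \<and> l ` {0..T} = {0..l T} \<and>
      l T = of_int \<lceil>real m * T\<rceil> / real m \<and> (\<forall>t\<in>{0..T}. \<bar>l t - t\<bar> \<le> 1 / real m) \<and>
      (\<forall>t\<in>{0..<T}. norm (x (of_int \<lfloor>real m * l t\<rfloor> / real m) - x t) \<le> e)) sequentially"
  using assms
proof (rule cadlag_induct)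
  show "eventually (\<lambda>m. \<exists>l. strict_mono_on {0..0} l \<and> l ` {0..0} = {0..l 0} \<and>
      l 0 = of_int \<lceil>real m * 0\<rceil> / real m \<and> (\<forall>t\<in>{0..0}. \<bar>l t - t\<bar> \<le> 1 / real m) \<and>
      (\<forall>t\<in>{0..<0}. norm (x (of_int \<lfloor>real m * l t\<rfloor> / real m) - x t) \<le> e)) sequentially"
    by (intro always_eventually allI exI[of _ "\<lambda>t. t"]) (auto simp: strict_mono_on_def)
next
  fix a b :: real
  assume ab: "0 \<le> a" "a < b"
    and osc: "\<And>u v. u \<in> {a..<b} \<Longrightarrow> v \<in> {a..<b} \<Longrightarrow> dist (x u) (x v) \<le> e"
    and IH: "eventually (\<lambda>m. \<exists>l. strict_mono_on {0..a} l \<and> l ` {0..a} = {0..l a} \<and>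
      l a = of_int \<lceil>real m * a\<rceil> / real m \<and> (\<forall>t\<in>{0..a}. \<bar>l t - t\<bar> \<le> 1 / real m) \<and>
      (\<forall>t\<in>{0..<a}. norm (x (of_int \<lfloor>real m * l t\<rfloor> / real m) - x t) \<le> e)) sequentially"
  \<comment> \<open>Once the mesh \<open>1 / m\<close> is shorter than the piece, \<open>a\<close>
    and \<open>b\<close> are rounded up to different grid points, and the extended time change is
    strictly increasing.\<close>
  have "eventually (\<lambda>m. 1 / (b - a) < real m) sequentially"
    using filterlim_real_sequentially by (simp add: filterlim_at_top_dense)
  with IH show "eventually (\<lambda>m. \<exists>l. strict_mono_on {0..b} l \<and> l ` {0..b} = {0..l b} \<and>
      l b = of_int \<lceil>real m * b\<rceil> / real m \<and> (\<forall>t\<in>{0..b}. \<bar>l t - t\<bar> \<le> 1 / real m) \<and>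
      (\<forall>t\<in>{0..<b}. norm (x (of_int \<lfloor>real m * l t\<rfloor> / real m) - x t) \<le> e)) sequentially"
  proof eventually_elim
    case (elim m)
    then obtain l where l: "strict_mono_on {0..a} l" "l ` {0..a} = {0..l a}"
      "l a = of_int \<lceil>real m * a\<rceil> / real m" "\<And>t. t \<in> {0..a} \<Longrightarrow> \<bar>l t - t\<bar> \<le> 1 / real m"
      "\<And>t. t \<in> {0..<a} \<Longrightarrow> norm (x (of_int \<lfloor>real m * l t\<rfloor> / real m) - x t) \<le> e"
      by blast
    have "0 < 1 / (b - a)" using ab by simp
    with elim have m: "real m > 0" by linarith
    have m': "real m * a + 1 < real m * b" using elim ab by (simp add: field_simps)
    define c where "c = of_int \<lceil>real m * b\<rceil> / real m"
    have mla: "real m * l a = of_int \<lceil>real m * a\<rceil>" and mc: "real m * c = of_int \<lceil>real m * b\<rceil>"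
      using m by (simp_all add: l(3) c_def)
    have "\<lceil>real m * a\<rceil> < \<lceil>real m * b\<rceil>" using m' by linarith
    hence lac: "l a < c" using m by (simp add: l(3) c_def divide_strict_right_mono)
    define k where "k = (\<lambda>t. if t \<le> a then l t else l a + (c - l a) / (b - a) * (t - a))"
    have ext: "strict_mono_on {0..b} k" "k ` {0..b} = {0..k b}" "k b = c"
      unfolding k_def by (rule time_changes_extend[OF l(1,2) ab lac])+
    have la: "a \<le> l a" "l a \<le> a + 1 / real m"
      and cb: "b \<le> c" "c \<le> b + 1 / real m"
      using m by (auto simp: l(3) c_def field_simps; linarith)+
    \<comment> \<open>On the affine piece the displacement \<open>k t - t\<close> is a convex
      combination of the displacements at \<open>a\<close> and \<open>b\<close>. Rounding up puts
      both of these between \<open>0\<close> and \<open>1 / m\<close>.\<close>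
    have conv: "k t - t = (1 - w) * (l a - a) + w * (c - b) \<and> k t = (1 - w) * l a + w * c"
      if "t > a" and w: "w = (t - a) / (b - a)" for t w
    proof -
      have "t = a + w * (b - a)" using that ab by simp
      moreover have "k t = l a + w * (c - l a)" using that by (simp add: k_def)
      ultimately show ?thesis by (simp add: algebra_simps)
    qed
    have near: "\<bar>k t - t\<bar> \<le> 1 / real m" if t: "t \<in> {0..b}" for t
    proof (cases "t \<le> a")
      case True thus ?thesis using l(4) t by (simp add: k_def)
    next
      case False
      define w where "w = (t - a) / (b - a)"
      have w: "0 \<le> w" "w \<le> 1" using False t ab by (auto simp: w_def)
      have kt: "k t - t = (1 - w) * (l a - a) + w * (c - b)"
        using conv[OF _ w_def] False by simp
      have "0 \<le> k t - t"
        unfolding kt using w la cb by (intro add_nonneg_nonneg mult_nonneg_nonneg) auto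
      moreover have "k t - t \<le> (1 - w) * (1 / real m) + w * (1 / real m)"
        unfolding kt using w la cb by (intro add_mono mult_left_mono) auto
      moreover have "(1 - w) * (1 / real m) + w * (1 / real m) = 1 / real m"
        by (simp only: distrib_right[symmetric]) simp
      ultimately show ?thesis by linarith
    qed
    \<comment> \<open>For \<open>t\<close> in the new piece, \<open>k t\<close> lies between the
      grid points \<open>l a\<close> and \<open>c\<close>, excluding \<open>c\<close>. Rounding it
      down therefore gives a grid point in \<open>{a..<b}\<close>, where the oscillation bound
      compares it with \<open>t\<close>.\<close>
    have val: "norm (x (of_int \<lfloor>real m * k t\<rfloor> / real m) - x t) \<le> e" if t: "t \<in> {0..<b}" for t
    proof (cases "t < a")
      case True thus ?thesis using l(5) t by (simp add: k_def)
    next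
      case False
      have "k a \<le> k t" "k t < k b"
        using False t ab strict_mono_onD[OF ext(1), of t b] strict_mono_onD[OF ext(1), of a t]
        by (cases "t = a"; simp)+
      hence "l a \<le> k t" "k t < c" using ext(3) by (simp_all add: k_def)
      hence "real m * l a \<le> real m * k t" "real m * k t < real m * c" using m by simp_all
      hence "\<lceil>real m * a\<rceil> \<le> \<lfloor>real m * k t\<rfloor>" "\<lfloor>real m * k t\<rfloor> < \<lceil>real m * b\<rceil>"
        unfolding mla mc by linarith+
      hence "real m * a \<le> of_int \<lfloor>real m * k t\<rfloor>" "of_int \<lfloor>real m * k t\<rfloor> < real m * b"
        by linarith+
      hence "of_int \<lfloor>real m * k t\<rfloor> / real m \<in> {a..<b}" using m by (simp add: field_simps)
      thus ?thesis using osc[of "of_int \<lfloor>real m * k t\<rfloor> / real m" t] False t by (simp add: dist_norm)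
    qed
    show ?case
      using ext near val by (intro exI[of _ k]) (auto simp: c_def)
  qed
qed

text \<open>The closeness supplied by \<open>grid_path_near\<close> leaves out the right end
  \<open>S\<close>, hence an \<open>S\<close> beyond \<open>T\<close>. After \<open>S\<close> the
  time change goes on as a translation, which keeps the displacement reached at
  \<open>S\<close>.\<close>

lemma grid_path_tendsto:
  fixes x :: "real \<Rightarrow> 'b::real_normed_vector"
  assumes x: "cadlag x" and "e > 0" "T > 0"
  shows "eventually (\<lambda>m. grid_path m x \<in> J1_nbhd x T e) sequentially"
proof -
  define S where "S = T + 1"
  have S: "S \<ge> 0" "T < S" using \<open>T > 0\<close> by (auto simp: S_def)
  \<comment> \<open>\<open>m > 1 / e\<close> makes the displacement \<open>1 / m\<close> at most
    \<open>e\<close>; \<open>m > T + 2\<close> puts the cut-off in \<open>grid_point\<close> beyond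
    every \<open>k t\<close> with \<open>t \<le> T\<close>.\<close>
  have "eventually (\<lambda>m. max (1/e) (T + 2) < real m) sequentially"
    using filterlim_real_sequentially unfolding filterlim_at_top_dense by blast
  with grid_path_near[OF x \<open>e > 0\<close> S(1)] show ?thesis
  proof eventually_elim
    case (elim m)
    then obtain l where l: "strict_mono_on {0..S} l" "l ` {0..S} = {0..l S}"
      "l S = of_int \<lceil>real m * S\<rceil> / real m" "\<And>t. t \<in> {0..S} \<Longrightarrow> \<bar>l t - t\<bar> \<le> 1 / real m"
      "\<And>t. t \<in> {0..<S} \<Longrightarrow> norm (x (of_int \<lfloor>real m * l t\<rfloor> / real m) - x t) \<le> e"
      by blast
    have m: "real m > 0" "1 / real m \<le> e" "T + 2 < real m" "1 / real m \<le> 1"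
      using elim \<open>e > 0\<close> \<open>T > 0\<close> by (auto simp: field_simps)
    define k where "k t = (if t \<le> S then l t else t + (l S - S))" for t
    have kl: "k t = l t" if "t \<le> S" for t using that by (simp add: k_def)
    have kr: "k t = t + (l S - S)" if "t \<ge> S" for t using that by (auto simp: k_def)
    have near: "\<bar>k t - t\<bar> \<le> 1 / real m" if "t \<ge> 0" for t
      using that l(4)[of t] l(4)[of S] S by (cases "t \<le> S") (auto simp: k_def)
    have "strict_mono_on {0..} k"
    proof (rule strict_mono_onI)
      fix u v :: real assume uv: "u \<in> {0..}" "v \<in> {0..}" "u < v"
      consider "v \<le> S" | "u \<ge> S" | "u < S" "v > S" by linarith
      thus "k u < k v"
      proof cases
        case 3
        hence "l u < l S" using l(1) S uv by (auto simp: strict_mono_on_def)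
        thus ?thesis using 3 by (simp add: k_def)
      qed (use uv l(1) in \<open>auto simp: kl kr strict_mono_on_def\<close>)
    qed
    moreover have "k ` {0..} = {0..}"
    proof -
      have "0 \<le> l S" using l(2) S by (metis atLeastAtMost_iff image_eqI order_refl)
      have "k ` {0..} = k ` {0..S} \<union> k ` {S..}"
        using S by (subst image_Un[symmetric]) (auto intro: arg_cong[where f = "\<lambda>A. k ` A"])
      also have "k ` {0..S} = {0..l S}" using l(2) image_cong[of "{0..S}" _ k l] by (simp add: kl)
      also have "k ` {S..} = (\<lambda>t. t + (l S - S)) ` {S..}" by (rule image_cong) (auto simp: kr)
      also have "\<dots> = {l S..}"
        by (auto simp: image_iff intro!: bexI[where x = "_ - (l S - S)"])
      also have "{0..l S} \<union> {l S..} = {0..}" using \<open>0 \<le> l S\<close> by auto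
      finally show ?thesis .
    qed
    ultimately have k: "k \<in> time_changes" by (simp add: time_changes_def)
    have "norm (grid_path m x (k t) - x t) \<le> e" if t: "t \<in> {0..T}" for t
    proof -
      have kt: "0 \<le> k t" "k t \<le> T + 1"
        using near[of t] t m(4) time_changes_nonneg[OF k, of t]
        unfolding atLeastAtMost_iff by linarith+
      have "of_int \<lfloor>real m * k t\<rfloor> / real m \<le> k t" using m by (simp add: field_simps)
      hence "grid_path m x (k t) = x (of_int \<lfloor>real m * k t\<rfloor> / real m)"
        using kt m by (simp add: grid_path_def grid_point_def min_def)
      thus ?thesis using l(5)[of t] t S by (simp add: k_def)
    qed
    moreover have "grid_path m x \<in> cadlag_paths" using m by (intro grid_path_cadlag_paths) auto
    ultimately show ?case
      using k near m(2) unfolding J1_nbhd_def by (auto intro!: bexI[of _ k] intro: order_trans)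
  qed
qed

text \<open>The Borel sets of the J1 topology are reached through the grid paths, which take countably many
  values: \<open>x\<close> lies in an open set \<open>U\<close> iff, for some \<open>k\<close>, all late grid paths of \<open>x\<close> have their
  neighbourhood with parameters \<open>k\<close> and \<open>1/k\<close> inside \<open>U\<close>.\<close>

lemma measurable_J1:
  fixes X :: "'a \<Rightarrow> real \<Rightarrow> 'b::real_normed_vector"
  assumes "countable V"
    and X: "\<And>t. t \<ge> 0 \<Longrightarrow> (\<lambda>\<omega>. X \<omega> t) \<in> measurable M (count_space V)"
    and paths: "\<And>\<omega>. \<omega> \<in> space M \<Longrightarrow> X \<omega> \<in> cadlag_paths"
  shows "X \<in> measurable M (borel_of J1_topology)"
  unfolding borel_of_def
proof (rule measurable_sigma_sets)
  show "sets (sigma (topspace J1_topology) {U. openin J1_topology U})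
      = sigma_sets (topspace J1_topology) {U. openin (J1_topology :: (real \<Rightarrow> 'b) topology) U}"
    by (rule sets_measure_of) (auto dest: openin_subset)
  show "{U. openin J1_topology U} \<subseteq> Pow (topspace (J1_topology :: (real \<Rightarrow> 'b) topology))"
    by (auto dest: openin_subset)
  show "X \<in> space M \<rightarrow> topspace J1_topology" using paths by (auto simp: topspace_J1_topology)
  fix U :: "(real \<Rightarrow> 'b) set" assume "U \<in> {U. openin J1_topology U}"
  hence U: "U \<subseteq> cadlag_paths" "\<And>x. x \<in> U \<Longrightarrow> \<exists>T>0. \<exists>e>0. J1_nbhd x T e \<subseteq> U"
    by (auto simp: openin_J1_topology)
  define F where "F k = {x. J1_nbhd x (real k) (1 / real k) \<subseteq> U}" for k :: nat
  have iff: "x \<in> U \<longleftrightarrow> (\<exists>k>0. \<exists>m\<^sub>0>0. \<forall>m\<ge>m\<^sub>0. grid_path m x \<in> F k)" if x: "x \<in> cadlag_paths" for x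
  proof
    have cx: "cadlag x" using x by (simp add: cadlag_paths_def)
    assume "x \<in> U"
    then obtain T e where Te: "T > 0" "e > 0" "J1_nbhd x T e \<subseteq> U" using U(2) by blast
    \<comment> \<open>For a grid path within \<open>e / 2\<close> of \<open>x\<close>, the
      neighbourhood with parameters \<open>T + e / 2\<close> and \<open>e / 2\<close> stays inside
      \<open>J1_nbhd x T e\<close>; \<open>k\<close> is large enough for its own neighbourhood to be
      smaller than that.\<close>
    define k where "k = nat \<lceil>max (T + e) (2 / e)\<rceil>"
    have "max (T + e) (2 / e) \<le> real k" unfolding k_def by linarith
    hence "T + e \<le> real k" "2 / e \<le> real k" by auto
    moreover from this Te have "k > 0" by (cases k) auto
    ultimately have k: "k > 0" "T + e / 2 \<le> real k" "1 / real k \<le> e / 2"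
      using Te by (auto simp: field_simps)
    have "eventually (\<lambda>m. grid_path m x \<in> F k) sequentially"
      using grid_path_tendsto[OF cx half_gt_zero[OF Te(2)] Te(1)]
    proof eventually_elim
      case (elim m)
      note 1 = elim
      have "J1_nbhd (grid_path m x) (real k) (1 / real k) \<subseteq> J1_nbhd (grid_path m x) (T + e/2) (e/2)"
        using k by (intro J1_nbhd_mono) auto
      also have "\<dots> \<subseteq> J1_nbhd x T (e/2 + e/2)" using J1_nbhd_trans[OF 1] by blast
      finally show ?case using Te by (simp add: F_def)
    qed
    then obtain m0 where "\<And>m. m \<ge> m0 \<Longrightarrow> grid_path m x \<in> F k"
      by (auto simp: eventually_sequentially)
    thus "\<exists>k>0. \<exists>m\<^sub>0>0. \<forall>m\<ge>m\<^sub>0. grid_path m x \<in> F k"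
      using k(1) by (intro exI[of _ k] exI[of _ "Suc m0"] conjI) auto
  next
    have cx: "cadlag x" using x by (simp add: cadlag_paths_def)
    assume "\<exists>k>0. \<exists>m\<^sub>0>0. \<forall>m\<ge>m\<^sub>0. grid_path m x \<in> F k"
    then obtain k m0 where k: "k > 0" and "\<forall>m\<ge>m0. grid_path m x \<in> F k" by blast
    hence "eventually (\<lambda>m. grid_path m x \<in> F k) sequentially"
      by (auto simp: eventually_sequentially)
    \<comment> \<open>Here the roles are exchanged: \<open>x\<close> must lie in the neighbourhood
      of its grid path. The additional \<open>1 / k\<close> in the horizon is the price of
      symmetry.\<close>
    moreover have "eventually (\<lambda>m. grid_path m x \<in> J1_nbhd x (real k + 1 / real k) (1 / real k)) sequentially"
      using k by (intro grid_path_tendsto[OF cx]) (auto intro: add_pos_pos)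
    ultimately have "eventually (\<lambda>m. x \<in> U) sequentially"
    proof eventually_elim
      case (elim m)
      thus ?case using J1_nbhd_sym[OF elim(2) x] by (auto simp: F_def)
    qed
    thus "x \<in> U" by simp
  qed
  \<comment> \<open>The grid path is a function \<open>h\<close> of the vector \<open>g\<close> of
    finitely many sampled values. These vectors form a countable set carrying all its subsets as
    events, so nothing has to be known about \<open>F k\<close>.\<close>
  have meas: "(\<lambda>\<omega>. grid_path m (X \<omega>)) -` F k \<inter> space M \<in> sets M" if "m > 0" for m k
  proof -
    define g where "g \<omega> = (\<lambda>i\<in>{..m*m}. X \<omega> (real i / real m))" for \<omega>
    define h where "h v = (\<lambda>t\<in>{0..}. v (min (nat \<lfloor>real m * t\<rfloor>) (m * m)))" for v :: "nat \<Rightarrow> 'b"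
    have "countable (PiE {..m*m} (\<lambda>_. V))"
      using \<open>countable V\<close> by (intro countable_PiE) auto
    moreover have "g \<in> measurable M (PiM {..m*m} (\<lambda>_. count_space V))"
      unfolding g_def by (intro measurable_restrict X) auto
    ultimately have g: "g \<in> measurable M (count_space (PiE {..m*m} (\<lambda>_. V)))"
      using \<open>countable V\<close> by (simp add: count_space_PiM_finite)
    have gp: "grid_path m (X \<omega>) = h (g \<omega>)" for \<omega>
    proof -
      have "grid_point m t = real (min (nat \<lfloor>real m * t\<rfloor>) (m * m)) / real m" if "t \<ge> 0" for t
        using that \<open>m > 0\<close> by (simp add: grid_point_def of_nat_min min_divide_distrib_right)
      thus ?thesis by (auto simp: grid_path_def h_def g_def)
    qed
    have "g -` {v. h v \<in> F k} \<inter> space M = g -` ({v. h v \<in> F k} \<inter> PiE {..m*m} (\<lambda>_. V)) \<inter> space M"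
      using measurable_space[OF g] by auto
    also have "\<dots> \<in> sets M" by (rule measurable_sets[OF g]) simp
    finally show ?thesis by (simp add: gp vimage_def)
  qed
  have "X -` U \<inter> space M =
      (\<Union>k\<in>{0<..}. \<Union>m\<^sub>0\<in>{0<..}. \<Inter>m\<in>{m\<^sub>0..}. (\<lambda>\<omega>. grid_path m (X \<omega>)) -` F k \<inter> space M)"
    using paths by (fastforce simp: iff)
  also have "\<dots> \<in> sets M"
    using meas by (intro sets.countable_UN'' sets.countable_INT' image_subsetI) auto
  finally show "X -` U \<inter> space M \<in> sets M" .
qed

subsection \<open>The fluid equations\<close>

text \<open>As \<open>u\<close> is merely integrable, its integral \<open>V\<close> need not be
  differentiable. The integral \<open>W\<close> of the continuous bound \<open>a + L * V\<close> is
  differentiable and dominates \<open>V\<close>, and this makes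
  \<open>exp (- L * t) * (a + L * W t)\<close> nonincreasing from its initial value
  \<open>a\<close>.\<close>

lemma gronwall:
  fixes u :: "real \<Rightarrow> real"
  assumes u: "u integrable_on {0..T}" and L: "L > 0"
    and bound: "\<And>t. t \<in> {0..T} \<Longrightarrow> u t \<le> a + L * integral {0..t} u"
    and t: "t \<in> {0..T}"
  shows "u t \<le> a * exp (L * t)"
proof -
  define V where "V t = integral {0..t} u" for t
  define W where "W t = integral {0..t} (\<lambda>r. a + L * V r)" for t
  define h where "h t = exp (- L * t) * (a + L * W t)" for t
  have contV: "continuous_on {0..T} V"
    unfolding V_def by (rule indefinite_integral_continuous_1[OF u])
  have contU: "continuous_on {0..T} (\<lambda>r. a + L * V r)" by (intro continuous_intros contV)
  have VW: "V r \<le> W r" if r: "r \<in> {0..T}" for r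
    unfolding V_def[of r] W_def
  proof (rule Henstock_Kurzweil_Integration.integral_le)
    show "u integrable_on {0..r}" using u by (rule integrable_on_subinterval) (use r in auto)
    show "(\<lambda>r. a + L * V r) integrable_on {0..r}"
      using contU r by (intro integrable_continuous_interval) (auto intro: continuous_on_subset)
    show "u v \<le> a + L * V v" if "v \<in> {0..r}" for v
      using bound[of v] that r by (simp add: V_def)
  qed
  have derivW: "(W has_real_derivative a + L * V r) (at r within {0..T})" if "r \<in> {0..T}" for r
    unfolding W_def using that by (rule integral_has_real_derivative[OF contU])
  have contW: "continuous_on {0..T} W"
    by (rule DERIV_continuous_on[OF derivW])
  have "h t \<le> h 0"
  proof (rule DERIV_nonpos_imp_decreasing_open[where f = h])
    show "continuous_on {0..t} h" unfolding h_def
      using contW t by (intro continuous_intros) (auto intro: continuous_on_subset)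
    fix r assume r: "0 < r" "r < t"
    have "(W has_real_derivative a + L * V r) (at r within {0<..<T})"
      using derivW[of r] r t by (auto intro: DERIV_subset)
    hence "(W has_real_derivative a + L * V r) (at r)"
      using r t at_within_open[of r "{0<..<T}"] by simp
    hence "(h has_real_derivative exp (- L * r) * (L * (L * V r - L * W r))) (at r)"
      unfolding h_def by (auto intro!: derivative_eq_intros simp: algebra_simps)
    moreover have "exp (- L * r) * (L * (L * V r - L * W r)) \<le> 0"
      using VW[of r] r t L by (intro mult_nonneg_nonpos) auto
    ultimately show "\<exists>y. (h has_real_derivative y) (at r) \<and> y \<le> 0" by blast
  qed (use t in simp)
  hence "exp (L * t) * h t \<le> exp (L * t) * a" by (simp add: h_def W_def)
  hence "a + L * W t \<le> a * exp (L * t)"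
    by (simp add: h_def mult_ac flip: exp_add mult.assoc)
  moreover have "u t \<le> a + L * V t" using bound[OF t] by (simp add: V_def)
  moreover have "L * V t \<le> L * W t" using VW[OF t] L by simp
  ultimately show ?thesis by linarith
qed

lemma lipschitz_continuous_on_UNIV:
  fixes F :: "'b::real_normed_vector \<Rightarrow> 'c::real_normed_vector"
  assumes "\<And>x y. norm (F x - F y) \<le> L * norm (x - y)" "L > 0"
  shows "continuous_on UNIV F"
  by (rule lipschitz_on_continuous_on[OF lipschitz_onI[where L = L]])
    (use assms in \<open>auto simp: dist_norm\<close>)

text \<open>The premise \<open>close\<close> says that \<open>y\<close> and \<open>z\<close> have
  nearly the same residual in the integral equation of \<open>F\<close>. With \<open>e = 0\<close>
  the lemma yields uniqueness; with a scaled path as \<open>y\<close> it yields convergence, and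
  such a path jumps, hence cadlag instead of continuous.\<close>

lemma integral_equation_stability:
  fixes y z :: "real \<Rightarrow> 'b::banach"
  assumes lip: "\<And>x y. norm (F x - F y) \<le> L * norm (x - y)" and L: "L > 0"
    and y: "cadlag y" and z: "cadlag z"
    and close: "\<And>t. t \<in> {0..T} \<Longrightarrow>
      norm (y t - z t - (integral {0..t} (\<lambda>u. F (y u)) - integral {0..t} (\<lambda>u. F (z u)))) \<le> e"
    and t: "t \<in> {0..T}"
  shows "norm (y t - z t) \<le> e * exp (L * t)"
proof -
  have F: "continuous_on UNIV F" using lip L by (rule lipschitz_continuous_on_UNIV)
  have int: "(\<lambda>u. F (y u)) integrable_on {0..t}" "(\<lambda>u. F (z u)) integrable_on {0..t}" for t
    by (intro cadlag_integrable cadlag_compose[OF _ F] y z)+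
  have "cadlag (\<lambda>t. norm (y t - z t))"
    using cadlag_compose[OF cadlag_Pair[OF y z], of "\<lambda>p. norm (fst p - snd p)"]
    by (simp add: continuous_intros)
  hence d: "(\<lambda>t. norm (y t - z t)) integrable_on {0..t}" for t by (rule cadlag_integrable)
  show ?thesis
  proof (rule gronwall[OF d L _ t])
    fix t assume t: "t \<in> {0..T}"
    have "norm (integral {0..t} (\<lambda>u. F (y u)) - integral {0..t} (\<lambda>u. F (z u)))
        = norm (integral {0..t} (\<lambda>u. F (y u) - F (z u)))"
      by (simp add: Henstock_Kurzweil_Integration.integral_diff int)
    also have "\<dots> \<le> integral {0..t} (\<lambda>u. L * norm (y u - z u))"
      using lip by (intro Henstock_Kurzweil_Integration.integral_norm_bound_integral
        Henstock_Kurzweil_Integration.integrable_diff int integrable_on_mult_right d) auto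
    also have "\<dots> = L * integral {0..t} (\<lambda>u. norm (y u - z u))" by simp
    finally show "norm (y t - z t) \<le> e + L * integral {0..t} (\<lambda>u. norm (y u - z u))"
      using close[OF t] norm_triangle_sub[of "y t - z t"
        "integral {0..t} (\<lambda>u. F (y u)) - integral {0..t} (\<lambda>u. F (z u))"]
      by linarith
  qed
qed

lemma integral_exp_mult:
  fixes c :: real
  assumes "c > 0" "t \<ge> 0"
  shows "((\<lambda>u. exp (c * u)) has_integral (exp (c * t) - 1) / c) {0..t}"
proof -
  have "((\<lambda>u. exp (c * u)) has_integral (exp (c * t) / c - exp (c * 0) / c)) {0..t}"
    using assms by (intro fundamental_theorem_of_calculus)
      (auto intro!: derivative_eq_intros simp flip: has_real_derivative_iff_has_vector_derivative)
  thus ?thesis by (simp add: diff_divide_distrib)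
qed

text \<open>Writing \<open>z t = exp (c * t) *\<^sub>R g t\<close> with \<open>c = 2 * L\<close> turns the Picard operator into a contraction
  of the bounded continuous functions on the whole half-line.\<close>

lemma integral_equation_solvable:
  fixes F :: "'b::banach \<Rightarrow> 'b"
  assumes lip: "\<And>x y. norm (F x - F y) \<le> L * norm (x - y)" and L: "L > 0"
  shows "\<exists>z :: real \<Rightarrow> 'b. continuous_on {0..} z \<and>
    (\<forall>t\<ge>0. z t = z\<^sub>0 + integral {0..t} (\<lambda>u. F (z u)))"
proof -
  define c where "c = 2 * L"
  have c: "c > 0" using L by (simp add: c_def)
  have F: "continuous_on UNIV F" using lip L by (rule lipschitz_continuous_on_UNIV)
  define I where "I g t = integral {0..t} (\<lambda>u. F (exp (c * u) *\<^sub>R apply_bcontfun g u))"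
    for g :: "real \<Rightarrow>\<^sub>C 'b" and t
  \<comment> \<open>Bounded continuous functions live on the whole line, so at negative times the
    image is frozen at its value at \<open>0\<close> by means of \<open>max t 0\<close>.\<close>
  define \<Psi> where "\<Psi> g t = exp (- c * max t 0) *\<^sub>R (z\<^sub>0 + I g (max t 0))"
    for g :: "real \<Rightarrow>\<^sub>C 'b" and t
  have Fg: "continuous_on A (\<lambda>u. F (exp (c * u) *\<^sub>R apply_bcontfun g u))" for g :: "real \<Rightarrow>\<^sub>C 'b" and A
    by (rule continuous_on_compose2[OF F]) (auto intro!: continuous_intros)
  have int: "(\<lambda>u. F (exp (c * u) *\<^sub>R apply_bcontfun g u)) integrable_on {0..t}" for g :: "real \<Rightarrow>\<^sub>C 'b" and t
    by (rule integrable_continuous_interval[OF Fg])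
  have contI: "continuous_on {0..} (I g)" for g
  proof -
    have "continuous_on {0..t} (I g)" for t
      unfolding I_def by (rule indefinite_integral_continuous_1[OF int])
    note contI = this
    have "continuous (at t within {0..}) (I g)" if "t \<ge> 0" for t
    proof -
      have "continuous (at t within {0..t+1}) (I g)"
        using contI[of "t+1"] that
        by (auto simp: continuous_on_eq_continuous_within)
      moreover have "at t within {0..t+1} = at t within {0..}"
        by (rule at_within_nhd[of t "{..<t+1}"]) auto
      ultimately show ?thesis by simp
    qed
    thus ?thesis by (simp add: continuous_on_eq_continuous_within)
  qed
  have cont: "continuous_on UNIV (\<Psi> g)" for g
    unfolding \<Psi>_def by (intro continuous_intros continuous_on_compose2[OF contI]) auto
  have Ibound: "norm (I g t - I h t) \<le> L * dist g h * ((exp (c * t) - 1) / c)" if "t \<ge> 0" for g h t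
  proof -
    note E = integral_exp_mult[OF c that]
    have "norm (I g t - I h t) = norm (integral {0..t}
        (\<lambda>u. F (exp (c * u) *\<^sub>R apply_bcontfun g u) - F (exp (c * u) *\<^sub>R apply_bcontfun h u)))"
      by (simp add: I_def Henstock_Kurzweil_Integration.integral_diff int)
    also have "\<dots> \<le> integral {0..t} (\<lambda>u. L * dist g h * exp (c * u))"
    proof (intro Henstock_Kurzweil_Integration.integral_norm_bound_integral
        Henstock_Kurzweil_Integration.integrable_diff int integrable_on_mult_right)
      show "(\<lambda>u. exp (c * u)) integrable_on {0..t}" using E by blast
      fix u
      have "norm (F (exp (c * u) *\<^sub>R apply_bcontfun g u) - F (exp (c * u) *\<^sub>R apply_bcontfun h u))
          \<le> L * norm (exp (c * u) *\<^sub>R apply_bcontfun g u - exp (c * u) *\<^sub>R apply_bcontfun h u)"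
        by (rule lip)
      also have "\<dots> = L * (exp (c * u) * dist (apply_bcontfun g u) (apply_bcontfun h u))"
        by (simp add: dist_norm flip: scaleR_diff_right)
      also have "\<dots> \<le> L * (exp (c * u) * dist g h)"
        using L by (intro mult_left_mono dist_bounded) auto
      finally show "norm (F (exp (c * u) *\<^sub>R apply_bcontfun g u) - F (exp (c * u) *\<^sub>R apply_bcontfun h u))
          \<le> L * dist g h * exp (c * u)" by (simp add: mult_ac)
    qed
    also have "\<dots> = L * dist g h * ((exp (c * t) - 1) / c)"
      using E by (simp add: integral_unique)
    finally show ?thesis .
  qed
  \<comment> \<open>The factor \<open>1/2\<close> is \<open>L / c\<close>: the growth
    \<open>exp (c * r) / c\<close> of the integral is cancelled by the weight
    \<open>exp (- c * r)\<close>.\<close>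
  have contr: "dist (\<Psi> g t) (\<Psi> h t) \<le> 1/2 * dist g h" for g h t
  proof -
    define r where "r = max t 0"
    have r: "r \<ge> 0" by (simp add: r_def)
    have "dist (\<Psi> g t) (\<Psi> h t) = exp (- c * r) * norm (I g r - I h r)"
      by (simp add: \<Psi>_def dist_norm r_def flip: scaleR_diff_right)
    also have "\<dots> \<le> exp (- c * r) * (L * dist g h * ((exp (c * r) - 1) / c))"
      using Ibound[OF r] by (intro mult_left_mono) auto
    also have "\<dots> \<le> exp (- c * r) * (L * dist g h * (exp (c * r) / c))"
      using L c by (intro mult_left_mono divide_right_mono) auto
    also have "\<dots> = 1/2 * dist g h"
      using L by (simp add: c_def exp_minus field_simps)
    finally show ?thesis .
  qed
  \<comment> \<open>At the zero function the operator is explicit, and it is bounded because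
    \<open>c * r * exp (- c * r) \<le> 1\<close>. The contraction estimate passes boundedness on to
    every \<open>g\<close>.\<close>
  have bnd: "bounded (range (\<Psi> g))" for g
  proof -
    have base: "norm (\<Psi> (const_bcontfun 0) t) \<le> norm z\<^sub>0 + norm (F 0) / c" for t
    proof -
      define r where "r = max t 0"
      have r: "r \<ge> 0" by (simp add: r_def)
      have "norm (\<Psi> (const_bcontfun 0) t) = exp (- c * r) * norm (z\<^sub>0 + r *\<^sub>R F 0)"
        using r by (simp add: \<Psi>_def I_def r_def const_bcontfun.rep_eq)
      also have "\<dots> \<le> exp (- c * r) * (norm z\<^sub>0 + r * norm (F 0))"
        using r norm_triangle_ineq[of z\<^sub>0 "r *\<^sub>R F 0"] by (intro mult_left_mono) auto
      also have "\<dots> = exp (- c * r) * norm z\<^sub>0 + exp (- c * r) * (c * r) * (norm (F 0) / c)"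
        using c by (simp add: field_simps)
      also have "\<dots> \<le> 1 * norm z\<^sub>0 + 1 * (norm (F 0) / c)"
      proof (intro add_mono mult_right_mono)
        show "exp (- c * r) \<le> 1" using r c by simp
        have "c * r \<le> exp (c * r)" using exp_ge_add_one_self[of "c * r"] by linarith
        thus "exp (- c * r) * (c * r) \<le> 1" by (simp add: exp_minus field_simps)
      qed (use c in auto)
      finally show ?thesis by simp
    qed
    have "norm (\<Psi> g t) \<le> norm z\<^sub>0 + norm (F 0) / c + 1/2 * dist g (const_bcontfun 0)" for t
      using base[of t] contr[of g t "const_bcontfun 0"]
        norm_triangle_sub[of "\<Psi> g t" "\<Psi> (const_bcontfun 0) t"] by (simp add: dist_norm)
    thus ?thesis by (auto intro!: boundedI)
  qed
  define \<Phi> where "\<Phi> g = Bcontfun (\<Psi> g)" for g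
  have \<Phi>: "apply_bcontfun (\<Phi> g) = \<Psi> g" for g
    unfolding \<Phi>_def using cont bnd by (intro Bcontfun_inverse) (simp add: bcontfun_def)
  have "dist (\<Phi> g) (\<Phi> h) \<le> 1/2 * dist g h" for g h
    by (rule dist_bound) (simp only: \<Phi> contr)
  hence "\<exists>!g. \<Phi> g = g"
    by (intro banach_fix_type[of "1/2"] allI) simp_all
  then obtain g where g: "\<Phi> g = g" by blast
  define z where "z t = exp (c * t) *\<^sub>R apply_bcontfun g t" for t
  have "continuous_on {0..} z" unfolding z_def by (intro continuous_intros) auto
  moreover have "\<forall>t\<ge>0. z t = z\<^sub>0 + integral {0..t} (\<lambda>u. F (z u))"
  proof (intro allI impI)
    fix t :: real assume "t \<ge> 0"
    have "z t = exp (c * t) *\<^sub>R \<Psi> g t" using \<Phi>[of g] by (simp add: z_def g)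
    also have "\<dots> = z\<^sub>0 + I g t" using \<open>t \<ge> 0\<close> by (simp add: \<Psi>_def exp_minus)
    finally show "z t = z\<^sub>0 + integral {0..t} (\<lambda>u. F (z u))" by (simp add: I_def z_def)
  qed
  ultimately show ?thesis by blast
qed

section \<open>The fluid equations as one integral equation with a Lipschitz drift\<close>

locale fluid_parameters =
  fixes lam mu theta dRD dRC p q :: real and s :: nat
  assumes pos: "lam > 0" "mu > 0" "theta > 0" "dRD > 0" "dRC > 0"
    and routing: "p \<in> {0..1}" "q \<in> {0..1}"
begin

definition drift :: "real^3 \<Rightarrow> real^3" where
  "drift x = vector
    [lam + dRD * x $ 2 + dRC * x $ 3 - mu * min (real s) (x $ 1) - theta * max (x $ 1 - real s) 0,
     p * theta * max (x $ 1 - real s) 0 - dRD * x $ 2,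
     q * mu * min (real s) (x $ 1) - dRC * x $ 3]"

text \<open>The factor \<open>2\<close> comes from the l1 norm: each of the four rates occurs in the
  queue component and in one orbit component, and \<open>p\<close>, \<open>q\<close> are at most
  \<open>1\<close>.\<close>

definition drift_lipschitz :: real where
  "drift_lipschitz = 2 * (mu + theta + dRD + dRC)"

lemma drift_lipschitz_pos: "drift_lipschitz > 0"
  using pos by (simp add: drift_lipschitz_def)

lemma drift_lipschitz: "norm (drift x - drift y) \<le> drift_lipschitz * norm (x - y)"
proof -
  define d where "d i = \<bar>x $ i - y $ i\<bar>" for i
  have d: "0 \<le> d i" "d i \<le> norm (x - y)" for i
    using component_le_norm_cart[of "x - y" i] by (simp_all add: d_def)
  have d_le: "\<bar>x $ i - y $ i\<bar> \<le> d i" for i by (simp add: d_def)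
  have m1: "\<bar>min (real s) (x $ 1) - min (real s) (y $ 1)\<bar> \<le> d 1"
    and m2: "\<bar>max (x $ 1 - real s) 0 - max (y $ 1 - real s) 0\<bar> \<le> d 1"
    unfolding d_def by (auto simp: min_def max_def)
  have mul: "\<bar>k * a - k * b\<bar> \<le> K * d i" if "\<bar>a - b\<bar> \<le> d i" "0 \<le> k" "k \<le> K" for k K a b i
  proof -
    have "\<bar>k * a - k * b\<bar> = k * \<bar>a - b\<bar>" using that by (simp add: abs_mult flip: right_diff_distrib)
    also have "\<dots> \<le> K * d i" using that by (intro mult_mono) auto
    finally show ?thesis .
  qed
  have pq: "0 \<le> p * theta" "p * theta \<le> theta" "0 \<le> q * mu" "q * mu \<le> mu"
    using pos routing by (simp_all add: mult_left_le_one_le)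
  have b: "\<bar>dRD * x $ 2 - dRD * y $ 2\<bar> \<le> dRD * d 2" "\<bar>dRC * x $ 3 - dRC * y $ 3\<bar> \<le> dRC * d 3"
    "\<bar>mu * min (real s) (x $ 1) - mu * min (real s) (y $ 1)\<bar> \<le> mu * d 1"
    "\<bar>theta * max (x $ 1 - real s) 0 - theta * max (y $ 1 - real s) 0\<bar> \<le> theta * d 1"
    "\<bar>p * theta * max (x $ 1 - real s) 0 - p * theta * max (y $ 1 - real s) 0\<bar> \<le> theta * d 1"
    "\<bar>q * mu * min (real s) (x $ 1) - q * mu * min (real s) (y $ 1)\<bar> \<le> mu * d 1"
    by (rule mul d_le m1 m2 pq less_imp_le[OF pos(2)] less_imp_le[OF pos(3)]
        less_imp_le[OF pos(4)] less_imp_le[OF pos(5)] order_refl)+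
  have "\<bar>(drift x - drift y) $ 1\<bar> \<le> dRD * d 2 + dRC * d 3 + mu * d 1 + theta * d 1"
    using b(1,2,3,4) unfolding drift_def vector_minus_component vector_3 abs_le_iff by linarith
  moreover have "\<bar>(drift x - drift y) $ 2\<bar> \<le> theta * d 1 + dRD * d 2"
    using b(1,5) unfolding drift_def vector_minus_component vector_3 abs_le_iff by linarith
  moreover have "\<bar>(drift x - drift y) $ 3\<bar> \<le> mu * d 1 + dRC * d 3"
    using b(2,6) unfolding drift_def vector_minus_component vector_3 abs_le_iff by linarith
  ultimately have comp: "(\<Sum>i\<in>UNIV. \<bar>(drift x - drift y) $ i\<bar>)
      \<le> 2 * mu * d 1 + 2 * theta * d 1 + 2 * dRD * d 2 + 2 * dRC * d 3"
    unfolding sum_3 by simp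
  have "norm (drift x - drift y) \<le> (\<Sum>i\<in>UNIV. \<bar>(drift x - drift y) $ i\<bar>)"
    by (rule norm_le_l1_cart)
  also have "\<dots> \<le> 2 * mu * d 1 + 2 * theta * d 1 + 2 * dRD * d 2 + 2 * dRC * d 3"
    by (rule comp)
  also have "\<dots> \<le> 2 * mu * norm (x - y) + 2 * theta * norm (x - y)
      + 2 * dRD * norm (x - y) + 2 * dRC * norm (x - y)"
    using pos d by (intro add_mono mult_left_mono) auto
  also have "\<dots> = drift_lipschitz * norm (x - y)" by (simp add: drift_lipschitz_def algebra_simps)
  finally show ?thesis .
qed

lemma continuous_drift: "continuous_on UNIV drift"
  using drift_lipschitz drift_lipschitz_pos by (rule lipschitz_continuous_on_UNIV)

text \<open>Stated for cadlag paths so that it serves the continuous solutions as well as the scaled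
  paths of the model.\<close>

lemma integral_drift:
  assumes x: "cadlag x" and "t \<ge> 0"
  shows "integral {0..t} (\<lambda>u. drift (x u)) $ 1 = lam * t + dRD * integral {0..t} (\<lambda>u. x u $ 2)
        + dRC * integral {0..t} (\<lambda>u. x u $ 3) - mu * integral {0..t} (\<lambda>u. min (real s) (x u $ 1))
        - theta * integral {0..t} (\<lambda>u. max (x u $ 1 - real s) 0)"
    and "integral {0..t} (\<lambda>u. drift (x u)) $ 2 =
        p * theta * integral {0..t} (\<lambda>u. max (x u $ 1 - real s) 0) - dRD * integral {0..t} (\<lambda>u. x u $ 2)"
    and "integral {0..t} (\<lambda>u. drift (x u)) $ 3 =
        q * mu * integral {0..t} (\<lambda>u. min (real s) (x u $ 1)) - dRC * integral {0..t} (\<lambda>u. x u $ 3)"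
proof -
  have int: "(\<lambda>u. f (x u)) integrable_on {0..t}" if "continuous_on UNIV f" for f :: "real^3 \<Rightarrow> 'c::banach"
    by (rule cadlag_integrable[OF cadlag_compose[OF x that]])
  have h: "((\<lambda>u. x u $ i) has_integral integral {0..t} (\<lambda>u. x u $ i)) {0..t}"
    "((\<lambda>u. min (real s) (x u $ 1)) has_integral integral {0..t} (\<lambda>u. min (real s) (x u $ 1))) {0..t}"
    "((\<lambda>u. max (x u $ 1 - real s) 0) has_integral integral {0..t} (\<lambda>u. max (x u $ 1 - real s) 0)) {0..t}"
    for i
    using int[of "\<lambda>v. v $ i"] int[of "\<lambda>v. min (real s) (v $ 1)"] int[of "\<lambda>v. max (v $ 1 - real s) 0"]
    by (auto simp: continuous_intros continuous_on_id intro!: integrable_integral)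
  have lam: "((\<lambda>u. lam) has_integral lam * t) {0..t}"
    using has_integral_const_real[of lam 0 t] \<open>t \<ge> 0\<close> by (simp add: mult.commute)
  have nth: "integral {0..t} (\<lambda>u. drift (x u)) $ i = integral {0..t} (\<lambda>u. drift (x u) $ i)" for i
    by (rule integral_component_eq_cart[symmetric]) (rule int[OF continuous_drift])
  show "integral {0..t} (\<lambda>u. drift (x u)) $ 1 = lam * t + dRD * integral {0..t} (\<lambda>u. x u $ 2)
        + dRC * integral {0..t} (\<lambda>u. x u $ 3) - mu * integral {0..t} (\<lambda>u. min (real s) (x u $ 1))
        - theta * integral {0..t} (\<lambda>u. max (x u $ 1 - real s) 0)"
    unfolding nth unfolding drift_def vector_3
    by (intro integral_unique has_integral_diff has_integral_add has_integral_mult_right h lam)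
  show "integral {0..t} (\<lambda>u. drift (x u)) $ 2 =
        p * theta * integral {0..t} (\<lambda>u. max (x u $ 1 - real s) 0) - dRD * integral {0..t} (\<lambda>u. x u $ 2)"
    unfolding nth unfolding drift_def vector_3
    by (intro integral_unique has_integral_diff has_integral_mult_right h)
  show "integral {0..t} (\<lambda>u. drift (x u)) $ 3 =
        q * mu * integral {0..t} (\<lambda>u. min (real s) (x u $ 1)) - dRC * integral {0..t} (\<lambda>u. x u $ 3)"
    unfolding nth unfolding drift_def vector_3
    by (intro integral_unique has_integral_diff has_integral_mult_right h)
qed

lemma fluid_solution_iff:
  "fluid_solution lam mu theta dRD dRC p q s z\<^sub>0 z \<longleftrightarrow>
    z \<in> extensional {0..} \<and> continuous_on {0..} z \<and>
    (\<forall>t\<ge>0. z t = z\<^sub>0 + integral {0..t} (\<lambda>u. drift (z u)))"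
proof (cases "continuous_on {0..} z")
  case True
  note I = integral_drift[OF continuous_on_cadlag[OF True]]
  show ?thesis
    using True unfolding fluid_solution_def
    by (auto simp: vec_eq_iff forall_3 I algebra_simps)
qed (simp add: fluid_solution_def)

lemma fluid_solution_unique:
  assumes "fluid_solution lam mu theta dRD dRC p q s z\<^sub>0 y" "fluid_solution lam mu theta dRD dRC p q s z\<^sub>0 z"
  shows "y = z"
proof (rule extensionalityI)
  show "y \<in> extensional {0..}" "z \<in> extensional {0..}" using assms by (auto simp: fluid_solution_iff)
  fix t :: real assume "t \<in> {0..}"
  hence "norm (y t - z t) \<le> 0 * exp (drift_lipschitz * t)"
    using assms by (intro integral_equation_stability[OF drift_lipschitz drift_lipschitz_pos, where T = t])
      (auto simp: fluid_solution_iff continuous_on_cadlag)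
  thus "y t = z t" by simp
qed

lemma fluid_solution_exists: "\<exists>z. fluid_solution lam mu theta dRD dRC p q s z\<^sub>0 z"
proof -
  obtain z :: "real \<Rightarrow> real^3" where z: "continuous_on {0..} z" "\<And>t. t \<ge> 0 \<Longrightarrow> z t = z\<^sub>0 + integral {0..t} (\<lambda>u. drift (z u))"
    using integral_equation_solvable[OF drift_lipschitz drift_lipschitz_pos] by blast
  have "integral {0..t} (\<lambda>u. drift (restrict z {0..} u)) = integral {0..t} (\<lambda>u. drift (z u))" for t
    by (rule integral_cong) simp
  hence "fluid_solution lam mu theta dRD dRC p q s z\<^sub>0 (restrict z {0..})"
    unfolding fluid_solution_iff using z continuous_on_cong[of "{0..}" "{0..}" z "restrict z {0..}"]
    by (simp add: restrict_extensional)
  thus ?thesis by blast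
qed

end

subsection \<open>Convergence with high probability\<close>

text \<open>The exceptional set \<open>N\<close> is there because \<open>E n\<close> itself need not be measurable.\<close>

definition whp :: "(nat \<Rightarrow> 'a measure) \<Rightarrow> (nat \<Rightarrow> 'a \<Rightarrow> bool) \<Rightarrow> bool" where
  "whp M E \<longleftrightarrow> (\<forall>r>0. eventually (\<lambda>n. \<exists>N\<in>sets (M n). measure (M n) N \<le> r \<and>
     (AE \<omega> in M n. \<omega> \<notin> N \<longrightarrow> E n \<omega>)) sequentially)"

lemma whp_conj:
  assumes "whp M E" "whp M E'"
  shows "whp M (\<lambda>n \<omega>. E n \<omega> \<and> E' n \<omega>)"
  unfolding whp_def
proof (intro allI impI)
  fix r :: real assume "r > 0"
  hence "r / 2 > 0" by simp
  have "eventually (\<lambda>n. \<exists>N\<in>sets (M n). measure (M n) N \<le> r / 2 \<and>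
     (AE \<omega> in M n. \<omega> \<notin> N \<longrightarrow> E n \<omega>)) sequentially"
    using assms(1) \<open>r / 2 > 0\<close> unfolding whp_def by blast
  moreover have "eventually (\<lambda>n. \<exists>N\<in>sets (M n). measure (M n) N \<le> r / 2 \<and>
     (AE \<omega> in M n. \<omega> \<notin> N \<longrightarrow> E' n \<omega>)) sequentially"
    using assms(2) \<open>r / 2 > 0\<close> unfolding whp_def by blast
  ultimately show "eventually (\<lambda>n. \<exists>N\<in>sets (M n). measure (M n) N \<le> r \<and>
     (AE \<omega> in M n. \<omega> \<notin> N \<longrightarrow> E n \<omega> \<and> E' n \<omega>)) sequentially"
  proof eventually_elim
    case (elim n)
    then obtain A B where A: "A \<in> sets (M n)" "measure (M n) A \<le> r / 2" "AE \<omega> in M n. \<omega> \<notin> A \<longrightarrow> E n \<omega>"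
      and B: "B \<in> sets (M n)" "measure (M n) B \<le> r / 2" "AE \<omega> in M n. \<omega> \<notin> B \<longrightarrow> E' n \<omega>"
      by blast
    have "measure (M n) (A \<union> B) \<le> r" using measure_Un_le[OF A(1) B(1)] A(2) B(2) by simp
    moreover have "AE \<omega> in M n. \<omega> \<notin> A \<union> B \<longrightarrow> E n \<omega> \<and> E' n \<omega>" using A(3) B(3) by eventually_elim auto
    ultimately show ?case using A(1) B(1) by (intro bexI[of _ "A \<union> B"]) auto
  qed
qed

text \<open>The implication is asked for almost everywhere only, since the equations of the model
  hold almost surely.\<close>

lemma whp_mono:
  assumes "whp M E" "eventually (\<lambda>n. AE \<omega> in M n. E n \<omega> \<longrightarrow> E' n \<omega>) sequentially"
  shows "whp M E'"
  unfolding whp_def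
proof (intro allI impI)
  fix r :: real assume "r > 0"
  hence "eventually (\<lambda>n. \<exists>N\<in>sets (M n). measure (M n) N \<le> r \<and>
     (AE \<omega> in M n. \<omega> \<notin> N \<longrightarrow> E n \<omega>)) sequentially"
    using assms(1) unfolding whp_def by blast
  with assms(2) show "eventually (\<lambda>n. \<exists>N\<in>sets (M n). measure (M n) N \<le> r \<and>
     (AE \<omega> in M n. \<omega> \<notin> N \<longrightarrow> E' n \<omega>)) sequentially"
  proof eventually_elim
    case (elim n)
    then obtain N where N: "N \<in> sets (M n)" "measure (M n) N \<le> r" "AE \<omega> in M n. \<omega> \<notin> N \<longrightarrow> E n \<omega>"
      by blast
    have "AE \<omega> in M n. \<omega> \<notin> N \<longrightarrow> E' n \<omega>" using N(3) elim(1) by eventually_elim auto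
    thus ?case using N by blast
  qed
qed

lemma whp_bound:
  assumes b: "b \<longlonglongrightarrow> (0::real)"
    and N: "\<And>n. n \<ge> 1 \<Longrightarrow> N n \<in> sets (M n)" "\<And>n. n \<ge> 1 \<Longrightarrow> measure (M n) (N n) \<le> b n"
    and E: "\<And>n \<omega>. n \<ge> 1 \<Longrightarrow> \<omega> \<in> space (M n) \<Longrightarrow> \<omega> \<notin> N n \<Longrightarrow> E n \<omega>"
  shows "whp M E"
  unfolding whp_def
proof (intro allI impI)
  fix r :: real assume "r > 0"
  hence "eventually (\<lambda>n. b n < r) sequentially" using b by (intro order_tendstoD)
  thus "eventually (\<lambda>n. \<exists>N\<in>sets (M n). measure (M n) N \<le> r \<and>
     (AE \<omega> in M n. \<omega> \<notin> N \<longrightarrow> E n \<omega>)) sequentially"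
    using eventually_ge_at_top[of 1]
  proof eventually_elim
    case (elim n)
    thus ?case using N[of n] E[of n] by (intro bexI[of _ "N n"] conjI AE_I2) auto
  qed
qed

section \<open>Convergence in distribution to a constant\<close>

lemma sets_borel_of: "sets (borel_of T) = sigma_sets (topspace T) {U. openin T U}"
  and space_borel_of: "space (borel_of T) = topspace T"
  unfolding borel_of_def
  by (rule sets_measure_of space_measure_of; auto dest: openin_subset)+

lemma continuous_map_borel_of:
  assumes "continuous_map T euclideanreal f"
  shows "f \<in> borel_measurable (borel_of T)"
proof (rule borel_measurableI)
  fix S :: "real set" assume "open S"
  hence "openin T {x \<in> topspace T. f x \<in> S}"
    using assms by (intro openin_continuous_map_preimage) auto
  moreover have "f -` S \<inter> space (borel_of T) = {x \<in> topspace T. f x \<in> S}"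
    by (auto simp: space_borel_of)
  ultimately show "f -` S \<inter> space (borel_of T) \<in> sets (borel_of T)"
    by (auto simp: sets_borel_of)
qed

text \<open>With the identity as time change, uniform closeness on \<open>{0..T}\<close> puts the
  path into a J1 neighbourhood of \<open>z\<close>. There a continuous \<open>f\<close> differs from
  \<open>f z\<close> by less than \<open>e / 2\<close>, and on the exceptional set by at most
  \<open>2 * B\<close>.\<close>

lemma whp_imp_converges_in_distribution_J1:
  fixes z :: "real \<Rightarrow> 'b::real_normed_vector"
  assumes M: "\<And>n. n \<ge> 1 \<Longrightarrow> prob_space (M n)"
    and X: "\<And>n. n \<ge> 1 \<Longrightarrow> X n \<in> measurable (M n) (borel_of J1_topology)"
    and z: "z \<in> cadlag_paths"
    and close: "\<And>T e. T > 0 \<Longrightarrow> e > 0 \<Longrightarrow> whp M (\<lambda>n \<omega>. \<forall>t\<in>{0..T}. norm (X n \<omega> t - z t) \<le> e)"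
  shows "converges_in_distribution J1_topology M X (return (borel_of J1_topology) z)"
  unfolding converges_in_distribution_def
proof (intro conjI allI impI X)
  fix f :: "(real \<Rightarrow> 'b) \<Rightarrow> real"
  assume "continuous_map J1_topology euclideanreal f \<and> bounded (f ` topspace J1_topology)"
  hence f: "continuous_map J1_topology euclideanreal f" and "bounded (f ` cadlag_paths)"
    by (auto simp: topspace_J1_topology)
  then obtain B where B: "B > 0" "\<And>x. x \<in> cadlag_paths \<Longrightarrow> \<bar>f x\<bar> \<le> B"
    by (auto simp: bounded_pos)
  note fm = continuous_map_borel_of[OF f]
  have lim: "(\<integral>x. f x \<partial>return (borel_of J1_topology) z) = f z"
    using z fm by (intro integral_return) (auto simp: space_borel_of topspace_J1_topology)
  show "(\<lambda>n. \<integral>\<omega>. f (X n \<omega>) \<partial>M n) \<longlonglongrightarrow> (\<integral>x. f x \<partial>return (borel_of J1_topology) z)"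
    unfolding lim
  proof (rule tendstoI)
    fix e :: real assume e: "e > 0"
    define U where "U = {x \<in> cadlag_paths. f x \<in> ball (f z) (e/2)}"
    have "openin J1_topology U"
      using openin_continuous_map_preimage[OF f, of "ball (f z) (e/2)"]
      by (simp add: U_def topspace_J1_topology)
    moreover have "z \<in> U" using z e by (simp add: U_def)
    ultimately obtain T d where Td: "T > 0" "d > 0" "J1_nbhd z T d \<subseteq> U"
      unfolding openin_J1_topology by blast
    \<comment> \<open>An exceptional set of this size contributes at most \<open>e / 4\<close>, for
      a total of \<open>3 * e / 4\<close>.\<close>
    have "e / (8 * B) > 0" using e B by simp
    with close[OF Td(1,2)]
    have "eventually (\<lambda>n. \<exists>N\<in>sets (M n). measure (M n) N \<le> e / (8 * B) \<and>
        (AE \<omega> in M n. \<omega> \<notin> N \<longrightarrow> (\<forall>t\<in>{0..T}. norm (X n \<omega> t - z t) \<le> d))) sequentially"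
      unfolding whp_def by blast
    thus "eventually (\<lambda>n. dist (\<integral>\<omega>. f (X n \<omega>) \<partial>M n) (f z) < e) sequentially"
      using eventually_ge_at_top[of 1]
    proof eventually_elim
      case (elim n)
      interpret prob_space "M n" using elim by (intro M)
      obtain N where N: "N \<in> sets (M n)" "prob N \<le> e / (8 * B)"
          "AE \<omega> in M n. \<omega> \<notin> N \<longrightarrow> (\<forall>t\<in>{0..T}. norm (X n \<omega> t - z t) \<le> d)"
        using elim(1) by (elim bexE conjE)
      have paths: "X n \<omega> \<in> cadlag_paths" if "\<omega> \<in> space (M n)" for \<omega>
        using measurable_space[OF X[OF elim(2)] that] by (simp add: space_borel_of topspace_J1_topology)
      have meas: "(\<lambda>\<omega>. f (X n \<omega>)) \<in> borel_measurable (M n)"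
        by (rule measurable_compose[OF X[OF elim(2)] fm])
      have int: "integrable (M n) (\<lambda>\<omega>. f (X n \<omega>))"
        using meas paths B by (intro integrable_const_bound[where B = B]) (auto intro!: AE_I2)
      have int2: "integrable (M n) (\<lambda>\<omega>. e / 2 + 2 * B * indicat_real N \<omega>)"
        using N(1) by (intro Bochner_Integration.integrable_add integrable_const integrable_mult_right
          integrable_real_indicator) (simp_all add: emeasure_eq_measure)
      have "\<bar>(\<integral>\<omega>. f (X n \<omega>) \<partial>M n) - f z\<bar> = \<bar>\<integral>\<omega>. f (X n \<omega>) - f z \<partial>M n\<bar>"
        using int by (simp add: prob_space)
      also have "\<dots> \<le> (\<integral>\<omega>. \<bar>f (X n \<omega>) - f z\<bar> \<partial>M n)"
        by (rule integral_abs_bound)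
      also have "\<dots> \<le> (\<integral>\<omega>. e / 2 + 2 * B * indicat_real N \<omega> \<partial>M n)"
      proof (rule integral_mono_AE)
        show "AE \<omega> in M n. \<bar>f (X n \<omega>) - f z\<bar> \<le> e / 2 + 2 * B * indicat_real N \<omega>"
          using N(3) AE_space
        proof eventually_elim
          case (elim \<omega>)
          show ?case
          proof (cases "\<omega> \<in> N")
            case True
            thus ?thesis using B(2)[OF paths[OF elim(2)]] B(2)[OF z] e by simp
          next
            case False
            hence "X n \<omega> \<in> J1_nbhd z T d"
              using elim Td paths id_time_changes by (auto simp: J1_nbhd_def intro!: bexI[of _ "\<lambda>t. t"])
            hence "X n \<omega> \<in> U" using Td by blast
            thus ?thesis using False by (simp add: U_def dist_real_def abs_minus_commute)
          qed
        qed
      qed (use int int2 in auto)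
      also have "\<dots> = e / 2 + 2 * B * prob N"
        using N(1) by (subst Bochner_Integration.integral_add)
          (simp_all add: prob_space emeasure_eq_measure integrable_real_indicator)
      also have "\<dots> \<le> e / 2 + 2 * B * (e / (8 * B))"
        using N B by (intro add_left_mono mult_left_mono) auto
      also have "\<dots> < e" using e B by (simp add: field_simps)
      finally show ?case by (simp add: dist_real_def)
    qed
  qed
qed

text \<open>The bounded continuous test function \<open>f\<close> vanishes at \<open>x\<close>, so
  its expectations tend to \<open>0\<close>. It equals \<open>1\<close> wherever the distance to
  \<open>x\<close> is at least \<open>e\<close>, and Markov's inequality applies.\<close>

lemma converges_in_distribution_imp_whp:
  fixes X :: "nat \<Rightarrow> 'a \<Rightarrow> 'b::real_normed_vector"
  assumes conv: "converges_in_distribution euclidean M X (return (borel_of euclidean) x)"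
    and M: "\<And>n. n \<ge> 1 \<Longrightarrow> prob_space (M n)" and e: "e > 0"
  shows "whp M (\<lambda>n \<omega>. norm (X n \<omega> - x) \<le> e)"
proof -
  define f where "f y = min 1 (norm (y - x) / e)" for y
  have contf: "continuous_map euclidean euclideanreal f"
    unfolding f_def using e by (auto intro!: continuous_intros)
  have f01: "0 \<le> f y" "f y \<le> 1" for y using e by (auto simp: f_def)
  have "bounded (range f)" using f01 by (intro boundedI[of _ 1]) auto
  hence "(\<lambda>n. \<integral>\<omega>. f (X n \<omega>) \<partial>M n) \<longlonglongrightarrow> (\<integral>y. f y \<partial>return (borel_of euclidean) x)"
    using conv contf by (auto simp: converges_in_distribution_def)
  also have "(\<integral>y. f y \<partial>return (borel_of euclidean) x) = f x"
    by (intro integral_return continuous_map_borel_of contf) (simp add: space_borel_of)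
  also have "f x = 0" by (simp add: f_def)
  finally have lim: "(\<lambda>n. \<integral>\<omega>. f (X n \<omega>) \<partial>M n) \<longlonglongrightarrow> 0" .
  have meas: "(\<lambda>\<omega>. f (X n \<omega>)) \<in> borel_measurable (M n)" if "n \<ge> 1" for n
    by (rule measurable_compose[OF _ continuous_map_borel_of[OF contf]])
      (use conv that in \<open>auto simp: converges_in_distribution_def\<close>)
  show ?thesis
  proof (rule whp_bound[OF lim])
    fix n :: nat assume n: "n \<ge> 1"
    interpret prob_space "M n" using n by (rule M)
    note [measurable] = meas[OF n]
    show sets: "{\<omega> \<in> space (M n). f (X n \<omega>) \<ge> 1} \<in> sets (M n)" by measurable
    have int: "integrable (M n) (\<lambda>\<omega>. f (X n \<omega>))"
      using f01 by (intro integrable_const_bound[where B = 1]) (auto intro!: AE_I2)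
    have "prob {\<omega> \<in> space (M n). f (X n \<omega>) \<ge> 1} \<le> (\<integral>\<omega>. f (X n \<omega>) \<partial>M n) / 1"
      using int f01 by (intro integral_Markov_inequality_measure[where A = "{}"]) auto
    thus "prob {\<omega> \<in> space (M n). f (X n \<omega>) \<ge> 1} \<le> (\<integral>\<omega>. f (X n \<omega>) \<partial>M n)" by simp
    fix \<omega> assume "\<omega> \<in> space (M n)" "\<omega> \<notin> {\<omega> \<in> space (M n). f (X n \<omega>) \<ge> 1}"
    hence "f (X n \<omega>) < 1" by simp
    thus "norm (X n \<omega> - x) \<le> e" using e by (simp add: f_def min_def split: if_splits)
  qed
qed

subsection \<open>Laws of large numbers for the primitives\<close>

text \<open>Shifting the index in the exponential series gives the first two factorial moments
  \<open>r\<close> and \<open>r * r\<close>. They are combined through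
  \<open>(k - r)^2 = k * (k - 1) + (1 - 2 * r) * k + r^2\<close>.\<close>

lemma poisson_variance:
  fixes r :: real
  assumes r: "r > 0"
  shows "has_bochner_integral (measure_pmf (poisson_pmf r)) (\<lambda>k. (real k - r)\<^sup>2) r"
proof -
  have e0: "(\<lambda>k. r ^ k / fact k) sums exp r"
    using exp_converges[of r] by (simp add: divide_inverse mult.commute)
  have "(\<lambda>k. real (Suc k) * (r ^ Suc k / fact (Suc k))) sums (r * exp r)"
    using sums_mult[OF e0, of r] by (simp add: field_simps del: of_nat_Suc)
  hence e1: "(\<lambda>k. real k * (r ^ k / fact k)) sums (r * exp r)"
    by (subst (asm) sums_Suc_iff) simp
  have "(\<lambda>k. real (Suc k) * (real (Suc k) - 1) * (r ^ Suc k / fact (Suc k))) sums (r * (r * exp r))"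
  proof -
    have "real (Suc k) * (real (Suc k) - 1) * (r ^ Suc k / fact (Suc k)) = r * (real k * (r ^ k / fact k))" for k
    proof -
      have eq: "real (Suc k) - 1 = real k" by simp
      show ?thesis unfolding eq by (simp add: field_simps del: of_nat_Suc)
    qed
    thus ?thesis using sums_mult[OF e1, of r] by (simp only:)
  qed
  hence e2: "(\<lambda>k. real k * (real k - 1) * (r ^ k / fact k)) sums (r * (r * exp r))"
    by (subst (asm) sums_Suc_iff) simp
  have "(\<lambda>k. exp (-r) * (real k * (real k - 1) * (r ^ k / fact k) + (1 - 2 * r) * (real k * (r ^ k / fact k))
      + r\<^sup>2 * (r ^ k / fact k))) sums (exp (-r) * (r * (r * exp r) + (1 - 2 * r) * (r * exp r) + r\<^sup>2 * exp r))"
    by (intro sums_mult sums_add e0 e1 e2)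
  also have "exp (-r) * (r * (r * exp r) + (1 - 2 * r) * (r * exp r) + r\<^sup>2 * exp r) = r"
    by (simp add: exp_minus field_simps power2_eq_square)
  also have "(\<lambda>k. exp (-r) * (real k * (real k - 1) * (r ^ k / fact k) + (1 - 2 * r) * (real k * (r ^ k / fact k))
      + r\<^sup>2 * (r ^ k / fact k))) = (\<lambda>k. pmf (poisson_pmf r) k *\<^sub>R (real k - r)\<^sup>2)"
    using r by (auto simp: fun_eq_iff field_simps power2_eq_square)
  finally have S: "(\<lambda>k. pmf (poisson_pmf r) k *\<^sub>R (real k - r)\<^sup>2) sums r" .
  hence "summable (\<lambda>k. norm (pmf (poisson_pmf r) k *\<^sub>R (real k - r)\<^sup>2))"
    by (simp add: sums_iff abs_mult)
  hence "has_bochner_integral (count_space UNIV) (\<lambda>k. pmf (poisson_pmf r) k *\<^sub>R (real k - r)\<^sup>2) r"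
    using S by (simp add: has_bochner_integral_iff integrable_count_space_nat_iff integral_count_space_nat sums_iff)
  thus ?thesis
    unfolding measure_pmf_eq_density by (intro has_bochner_integral_density) auto
qed

lemma poisson_deviation:
  assumes "r > 0" "a > 0"
  shows "measure_pmf.prob (poisson_pmf r) {k. \<bar>real k - r\<bar> \<ge> a} \<le> r / a\<^sup>2"
proof -
  have "measure_pmf.prob (poisson_pmf r) {k \<in> space (measure_pmf (poisson_pmf r)). (real k - r)\<^sup>2 \<ge> a\<^sup>2}
      \<le> (\<integral>k. (real k - r)\<^sup>2 \<partial>measure_pmf (poisson_pmf r)) / a\<^sup>2"
    using poisson_variance[OF assms(1)] assms(2)
    by (intro integral_Markov_inequality_measure[where A = "{}"]) (auto simp: has_bochner_integral_iff)
  moreover have "a\<^sup>2 \<le> (real k - r)\<^sup>2 \<longleftrightarrow> a \<le> \<bar>real k - r\<bar>" for k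
    using assms(2) abs_le_square_iff[of a "real k - r"] by simp
  ultimately show ?thesis
    using poisson_variance[OF assms(1)] by (simp add: has_bochner_integral_iff)
qed

lemma poisson_process_deviation:
  assumes N: "poisson_process M r N" and "r > 0" "t \<ge> 0" "a > 0"
  shows "{\<omega> \<in> space M. \<bar>real (N t \<omega>) - r * t\<bar> \<ge> a} \<in> sets M"
    and "measure M {\<omega> \<in> space M. \<bar>real (N t \<omega>) - r * t\<bar> \<ge> a} \<le> r * t / a\<^sup>2"
proof -
  have Nm: "N t \<in> measurable M (count_space UNIV)" "N 0 \<in> measurable M (count_space UNIV)"
    and N0: "\<And>\<omega>. \<omega> \<in> space M \<Longrightarrow> N 0 \<omega> = 0"
    using N \<open>t \<ge> 0\<close> by (auto simp: poisson_process_def)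
  have "N t -` {k. \<bar>real k - r * t\<bar> \<ge> a} \<inter> space M \<in> sets M"
    by (rule measurable_sets[OF Nm(1)]) simp
  thus "{\<omega> \<in> space M. \<bar>real (N t \<omega>) - r * t\<bar> \<ge> a} \<in> sets M"
    by (simp add: vimage_def Int_def conj_commute)
  show "measure M {\<omega> \<in> space M. \<bar>real (N t \<omega>) - r * t\<bar> \<ge> a} \<le> r * t / a\<^sup>2"
  \<comment> \<open>The law of increments is given for \<open>a < b\<close> only, so time
    \<open>0\<close> is settled by \<open>N 0 = 0\<close>.\<close>
  proof (cases "t = 0")
    case True
    hence empty: "{\<omega> \<in> space M. \<bar>real (N t \<omega>) - r * t\<bar> \<ge> a} = {}" using N0 \<open>a > 0\<close> by auto
    show ?thesis unfolding empty using True by simp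
  next
    case False
    with \<open>t \<ge> 0\<close> have t: "t > 0" by simp
    have D: "distr M (count_space UNIV) (\<lambda>\<omega>. N t \<omega> - N 0 \<omega>) = measure_pmf (poisson_pmf (r * t))"
      using N t unfolding poisson_process_def by (metis diff_zero order_refl)
    have meas: "(\<lambda>\<omega>. N t \<omega> - N 0 \<omega>) \<in> measurable M (count_space UNIV)"
      using measurable_cong[of M "\<lambda>\<omega>. N t \<omega> - N 0 \<omega>" "N t"] N0 Nm by simp
    have "measure M {\<omega> \<in> space M. \<bar>real (N t \<omega>) - r * t\<bar> \<ge> a} =
        measure M ((\<lambda>\<omega>. N t \<omega> - N 0 \<omega>) -` {k. \<bar>real k - r * t\<bar> \<ge> a} \<inter> space M)"
      using N0 by (intro arg_cong[where f = "measure M"]) auto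
    also have "\<dots> = measure_pmf.prob (poisson_pmf (r * t)) {k. \<bar>real k - r * t\<bar> \<ge> a}"
      by (subst D[symmetric], subst measure_distr[OF meas]) auto
    also have "\<dots> \<le> r * t / a\<^sup>2"
      using t \<open>r > 0\<close> \<open>a > 0\<close> by (intro poisson_deviation) auto
    finally show ?thesis .
  qed
qed

text \<open>One \<open>a\<close> is the deviation allowed at the grid points, the other the growth
  of \<open>r * t\<close> over one mesh \<open>T / K\<close>. The factor \<open>K + 1\<close> counts
  the grid points, both ends included.\<close>

lemma poisson_process_uniform_deviation:
  assumes N: "poisson_process M r N" and r: "r > 0" and T: "T > 0" and a: "a > 0"
    and K: "r * T / real K \<le> a" "K > 0"
  shows "\<exists>A\<in>sets M. measure M A \<le> (real K + 1) * (r * T / a\<^sup>2) \<and>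
    (\<forall>\<omega>\<in>space M - A. \<forall>t\<in>{0..T}. \<bar>real (N t \<omega>) - r * t\<bar> \<le> 2 * a)"
proof -
  define \<tau> where "\<tau> i = real i * T / real K" for i
  define A where "A i = {\<omega> \<in> space M. \<bar>real (N (\<tau> i) \<omega>) - r * \<tau> i\<bar> \<ge> a}" for i
  have \<tau>: "0 \<le> \<tau> i" for i using T by (simp add: \<tau>_def)
  have \<tau>T: "\<tau> i \<le> T" if "i \<le> K" for i using T K that by (simp add: \<tau>_def field_simps)
  have A: "A i \<in> sets M" "measure M (A i) \<le> r * \<tau> i / a\<^sup>2" for i
    unfolding A_def using poisson_process_deviation[OF N r \<tau> a] by blast+
  have "measure M (\<Union>i\<in>{..K}. A i) \<le> (\<Sum>i\<in>{..K}. measure M (A i))"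
    using A by (intro measure_UNION_le) auto
  also have "\<dots> \<le> (\<Sum>i\<in>{..K}. r * T / a\<^sup>2)"
    using A(2) \<tau>T r by (intro sum_mono order.trans[OF A(2)] divide_right_mono mult_left_mono) auto
  also have "\<dots> = (real K + 1) * (r * T / a\<^sup>2)" by simp
  finally have m: "measure M (\<Union>i\<in>{..K}. A i) \<le> (real K + 1) * (r * T / a\<^sup>2)" .
  have "\<bar>real (N t \<omega>) - r * t\<bar> \<le> 2 * a" if \<omega>: "\<omega> \<in> space M" "\<omega> \<notin> (\<Union>i\<in>{..K}. A i)" and t: "t \<in> {0..T}" for \<omega> t
  proof -
    have good: "\<bar>real (N (\<tau> i) \<omega>) - r * \<tau> i\<bar> < a" if "i \<le> K" for i
      using \<omega> that by (force simp: A_def not_le)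
    have mono: "N u \<omega> \<le> N v \<omega>" if "0 \<le> u" "u \<le> v" for u v
      using N \<omega>(1) that by (auto simp: poisson_process_def mono_on_def)
    define i where "i = nat \<lfloor>t * K / T\<rfloor>"
    \<comment> \<open>The cap at \<open>K\<close> matters for \<open>t = T\<close>, where
      \<open>i\<close> is already \<open>K\<close>.\<close>
    define j where "j = min (Suc i) K"
    have "t * K / T \<ge> 0" using t T by simp
    hence i: "real i \<le> t * K / T" "t * K / T < real i + 1" unfolding i_def by linarith+
    have "t * K / T \<le> K" using t T K by (simp add: field_simps)
    hence "i \<le> K" "j \<le> K" using i by (auto simp: j_def)
    have ti: "\<tau> i \<le> t" "t \<le> \<tau> i + T / K" using i T K by (auto simp: \<tau>_def field_simps)
    have tj: "t \<le> \<tau> j" "\<tau> j \<le> t + T / K"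
    proof -
      have "t \<le> real (Suc i) * T / K" using i(2) T K by (simp add: field_simps)
      thus "t \<le> \<tau> j" using t K by (auto simp: j_def \<tau>_def min_def)
      have "\<tau> j \<le> real (Suc i) * T / K" using T by (auto simp: \<tau>_def j_def intro!: divide_right_mono)
      also have "\<dots> = \<tau> i + T / K" by (simp add: \<tau>_def field_simps add_divide_distrib)
      finally show "\<tau> j \<le> t + T / K" using ti by simp
    qed
    have "r * (T / K) \<le> a" using K by simp
    have "real (N t \<omega>) \<le> real (N (\<tau> j) \<omega>)" using mono t tj by simp
    also have "\<dots> \<le> r * \<tau> j + a" using good[OF \<open>j \<le> K\<close>] by linarith
    also have "r * \<tau> j \<le> r * (t + T / K)" using r tj by (intro mult_left_mono) auto
    also have "\<dots> \<le> r * t + a" using \<open>r * (T / K) \<le> a\<close> by (simp add: algebra_simps)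
    finally have up: "real (N t \<omega>) \<le> r * t + 2 * a" by simp
    have "r * (t - T / K) \<le> r * \<tau> i" using r ti by (intro mult_left_mono) auto
    hence "r * t - a \<le> r * \<tau> i" using \<open>r * (T / K) \<le> a\<close> by (simp add: algebra_simps)
    moreover have "r * \<tau> i - a \<le> real (N (\<tau> i) \<omega>)" using good[OF \<open>i \<le> K\<close>] by linarith
    moreover have "real (N (\<tau> i) \<omega>) \<le> real (N t \<omega>)" using mono \<tau> ti by simp
    ultimately show ?thesis using up by linarith
  qed
  thus ?thesis using A(1) m by (intro bexI[of _ "\<Union>i\<in>{..K}. A i"]) auto
qed

text \<open>The mean \<open>r n * T n\<close> and the tolerance \<open>e * n\<close> are both of
  order \<open>n\<close>, so one \<open>K\<close> serves all \<open>n\<close> and the bound is of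
  order \<open>1 / n\<close>. This form covers a growing rate on a fixed interval (fresh calls) and
  the unit rate on a growing interval (the four clocks).\<close>

lemma whp_poisson_process:
  assumes N: "\<And>n. n \<ge> 1 \<Longrightarrow> poisson_process (M n) (r n) (N n)"
    and r: "\<And>n. n \<ge> 1 \<Longrightarrow> r n > 0" "\<And>n. n \<ge> 1 \<Longrightarrow> T n > 0" "\<And>n. n \<ge> 1 \<Longrightarrow> r n * T n = c * real n"
    and c: "c > 0" and e: "e > 0"
  shows "whp M (\<lambda>n \<omega>. \<forall>t\<in>{0..T n}. \<bar>real (N n t \<omega>) - r n * t\<bar> \<le> e * real n)"
proof -
  define K where "K = nat \<lceil>2 * c / e\<rceil>"
  have "2 * c / e > 0" using c e by simp
  hence K: "K > 0" "2 * c / e \<le> real K" unfolding K_def by linarith+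
  define b where "b n = (real K + 1) * (c * real n / (e * real n / 2)\<^sup>2)" for n
  have b: "b \<longlonglongrightarrow> 0"
  proof -
    have "(\<lambda>n. (real K + 1) * c * 4 / e\<^sup>2 * (1 / real n)) \<longlonglongrightarrow> (real K + 1) * c * 4 / e\<^sup>2 * 0"
      by (intro tendsto_mult_left lim_1_over_n)
    moreover have "(real K + 1) * c * 4 / e\<^sup>2 * (1 / real n) = b n" for n
      by (simp add: b_def power2_eq_square)
    ultimately show ?thesis by simp
  qed
  have "\<exists>A\<in>sets (M n). measure (M n) A \<le> b n \<and>
      (\<forall>\<omega>\<in>space (M n) - A. \<forall>t\<in>{0..T n}. \<bar>real (N n t \<omega>) - r n * t\<bar> \<le> e * real n)" if n: "n \<ge> 1" for n
  proof -
    have "r n * T n / real K \<le> e * real n / 2"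
      using K n e r(3)[OF n] by (simp add: field_simps)
    from poisson_process_uniform_deviation[OF N[OF n] r(1,2)[OF n] _ this K(1)] show ?thesis
      using n e by (simp add: b_def r(3)[OF n])
  qed
  then obtain A where A: "\<And>n. n \<ge> 1 \<Longrightarrow> A n \<in> sets (M n)" "\<And>n. n \<ge> 1 \<Longrightarrow> measure (M n) (A n) \<le> b n"
    "\<And>n \<omega> t. n \<ge> 1 \<Longrightarrow> \<omega> \<in> space (M n) \<Longrightarrow> \<omega> \<notin> A n \<Longrightarrow> t \<in> {0..T n} \<Longrightarrow>
      \<bar>real (N n t \<omega>) - r n * t\<bar> \<le> e * real n"
    by (metis DiffI)
  show ?thesis by (rule whp_bound[OF b A(1,2)]) (use A(3) in auto)
qed

section \<open>Bernoulli sums\<close>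

lemma iid_bernoulli_deviation:
  assumes "prob_space M" and B: "iid_bernoulli M p B" and p: "p \<in> {0..1}" and "k > 0" "a \<ge> 0"
  shows "{\<omega> \<in> space M. \<bar>(\<Sum>j=1..k. of_bool (B j \<omega>)) - p * real k\<bar> \<ge> a} \<in> sets M"
    and "measure M {\<omega> \<in> space M. \<bar>(\<Sum>j=1..k. of_bool (B j \<omega>)) - p * real k\<bar> \<ge> a} \<le> 2 * exp (- 2 * a\<^sup>2 / real k)"
proof -
  interpret prob_space M by fact
  define X where "X j \<omega> = (of_bool (B j \<omega>) :: real)" for j \<omega>
  have Bm: "B j \<in> measurable M (count_space UNIV)" if "j \<ge> 1" for j
    using B that by (auto simp: iid_bernoulli_def indep_vars_def)
  have Xm: "X j \<in> borel_measurable M" if "j \<ge> 1" for j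
    unfolding X_def by (rule measurable_compose[OF Bm[OF that]]) simp
  have "indep_vars (\<lambda>_. borel) X {1..}"
    unfolding X_def using B by (intro indep_vars_compose2[where M' = "\<lambda>_. count_space UNIV" and Y = "\<lambda>_. of_bool"])
      (auto simp: iid_bernoulli_def)
  hence indep: "indep_vars (\<lambda>_. borel) X {1..k}" by (rule indep_vars_subset) auto
  have EX: "expectation (X j) = p" if "j \<ge> 1" for j
  proof -
    have "expectation (X j) = (\<integral>b. of_bool b \<partial>distr M (count_space UNIV) (B j))"
      unfolding X_def by (rule integral_distr[symmetric, OF Bm[OF that]]) simp
    also have "distr M (count_space UNIV) (B j) = measure_pmf (bernoulli_pmf p)"
      using B that by (simp add: iid_bernoulli_def)
    also have "(\<integral>b. of_bool b \<partial>measure_pmf (bernoulli_pmf p)) = p" using p by simp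
    finally show ?thesis .
  qed
  interpret H: Hoeffding_ineq M "{1..k}" X "\<lambda>_. 0" "\<lambda>_. 1" "p * real k"
  proof unfold_locales
    show "finite {1..k}" "indep_vars (\<lambda>_. borel) X {1..k}" by (rule finite_atLeastAtMost indep)+
    show "AE \<omega> in M. X i \<omega> \<in> {0..1}" for i by (simp add: X_def)
    show "p * real k \<equiv> \<Sum>i = 1..k. expectation (X i)" by (simp add: EX mult.commute)
  qed
  show "measure M {\<omega> \<in> space M. \<bar>(\<Sum>j=1..k. of_bool (B j \<omega>)) - p * real k\<bar> \<ge> a} \<le> 2 * exp (- 2 * a\<^sup>2 / real k)"
    using H.Hoeffding_ineq_abs_ge[OF \<open>a \<ge> 0\<close>] \<open>k > 0\<close> by (simp add: X_def)
  have [measurable]: "(\<lambda>\<omega>. \<Sum>j=1..k. X j \<omega>) \<in> borel_measurable M"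
    by (intro borel_measurable_sum Xm) auto
  have "{\<omega> \<in> space M. \<bar>(\<Sum>j=1..k. X j \<omega>) - p * real k\<bar> \<ge> a} \<in> sets M" by measurable
  thus "{\<omega> \<in> space M. \<bar>(\<Sum>j=1..k. of_bool (B j \<omega>)) - p * real k\<bar> \<ge> a} \<in> sets M" by (simp add: X_def)
qed

text \<open>A union bound over all \<open>k\<close> up to \<open>c * n\<close> suffices, because
  Hoeffding's bound is exponentially small in \<open>n\<close>, uniformly in these \<open>k\<close>.
  A variance bound of order \<open>1 / n\<close> for each \<open>k\<close> would not survive about
  \<open>c * n\<close> events.\<close>

lemma whp_iid_bernoulli:
  assumes M: "\<And>n. n \<ge> 1 \<Longrightarrow> prob_space (M n)"
    and B: "\<And>n. n \<ge> 1 \<Longrightarrow> iid_bernoulli (M n) p (B n)" and p: "p \<in> {0..1}"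
    and c: "c > 0" and e: "e > 0"
  shows "whp M (\<lambda>n \<omega>. \<forall>k. real k \<le> c * real n \<longrightarrow>
    \<bar>(\<Sum>j=1..k. of_bool (B n j \<omega>)) - p * real k\<bar> \<le> e * real n)"
proof -
  define I where "I n = {1..nat \<lfloor>c * real n\<rfloor>}" for n
  define A where "A n k = {\<omega> \<in> space (M n). \<bar>(\<Sum>j=1..k. of_bool (B n j \<omega>)) - p * real k\<bar> \<ge> e * real n}" for n k
  define b where "b n = c * real n * (2 * exp (- 2 * e\<^sup>2 / c * real n))" for n
  have I: "k > 0" "real k \<le> c * real n" if "k \<in> I n" for k n
    using that c by (auto simp: I_def le_nat_iff) (simp add: le_floor_iff)
  have b: "b \<longlonglongrightarrow> 0"
  proof -
    have "exp (- 2 * e\<^sup>2 / c) < 1" using c e by simp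
    hence "(\<lambda>n. 2 * c * (real n * exp (- 2 * e\<^sup>2 / c) ^ n)) \<longlonglongrightarrow> 2 * c * 0"
      by (intro tendsto_mult_left powser_times_n_limit_0) simp
    thus ?thesis by (simp add: b_def[abs_def] mult_ac flip: exp_of_nat_mult)
  qed
  have A: "A n k \<in> sets (M n)" "measure (M n) (A n k) \<le> 2 * exp (- 2 * e\<^sup>2 / c * real n)"
    if "n \<ge> 1" "k \<in> I n" for n k
  proof -
    note dev = iid_bernoulli_deviation[OF M[OF that(1)] B[OF that(1)] p I(1)[OF that(2)], of "e * real n"]
    show "A n k \<in> sets (M n)" unfolding A_def using e by (intro dev) simp
    have "measure (M n) (A n k) \<le> 2 * exp (- 2 * (e * real n)\<^sup>2 / real k)"
      unfolding A_def using e by (intro dev) simp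
    also have "2 * (e * real n)\<^sup>2 / (c * real n) \<le> 2 * (e * real n)\<^sup>2 / real k"
      using I[OF that(2)] by (intro divide_left_mono) auto
    hence "2 * exp (- 2 * (e * real n)\<^sup>2 / real k) \<le> 2 * exp (- 2 * e\<^sup>2 / c * real n)"
      using that(1) by (simp add: power2_eq_square field_simps)
    finally show "measure (M n) (A n k) \<le> 2 * exp (- 2 * e\<^sup>2 / c * real n)" .
  qed
  show ?thesis
  proof (rule whp_bound[OF b, where N = "\<lambda>n. \<Union>k\<in>I n. A n k"])
    fix n :: nat assume n: "n \<ge> 1"
    show "(\<Union>k\<in>I n. A n k) \<in> sets (M n)" using A(1)[OF n] by (intro sets.finite_UN) (auto simp: I_def)
    have "measure (M n) (\<Union>k\<in>I n. A n k) \<le> (\<Sum>k\<in>I n. measure (M n) (A n k))"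
      using A(1)[OF n] by (intro measure_UNION_le) (auto simp: I_def)
    also have "\<dots> \<le> real (card (I n)) * (2 * exp (- 2 * e\<^sup>2 / c * real n))"
      using A(2)[OF n] by (intro sum_bounded_above)
    also have "\<dots> \<le> b n"
      unfolding b_def using c by (intro mult_right_mono) (auto simp: I_def)
    finally show "measure (M n) (\<Union>k\<in>I n. A n k) \<le> b n" .
    fix \<omega> assume \<omega>: "\<omega> \<in> space (M n)" "\<omega> \<notin> (\<Union>k\<in>I n. A n k)"
    show "\<forall>k. real k \<le> c * real n \<longrightarrow> \<bar>(\<Sum>j=1..k. of_bool (B n j \<omega>)) - p * real k\<bar> \<le> e * real n"
    proof (intro allI impI)
      fix k :: nat assume k: "real k \<le> c * real n"
      show "\<bar>(\<Sum>j=1..k. of_bool (B n j \<omega>)) - p * real k\<bar> \<le> e * real n"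
      proof (cases "k = 0")
        case False
        hence "k \<in> I n" using k by (auto simp: I_def le_nat_iff le_floor_iff)
        thus ?thesis using \<omega> by (force simp: A_def not_le)
      qed (use e in simp)
    qed
  qed
qed

subsection \<open>The call center model\<close>

lemma fluid_scaled_nth [simp]:
  "fluid_scaled n ZQ ZRD ZRC t \<omega> $ 1 = real (ZQ t \<omega>) / real n"
  "fluid_scaled n ZQ ZRD ZRC t \<omega> $ 2 = real (ZRD t \<omega>) / real n"
  "fluid_scaled n ZQ ZRD ZRC t \<omega> $ 3 = real (ZRC t \<omega>) / real n"
  by (simp_all add: fluid_scaled_def)

lemma (in call_center_model) cadlag_fluid_scaled:
  assumes "\<omega> \<in> space M"
  shows "cadlag (\<lambda>t. fluid_scaled n ZQ ZRD ZRC t \<omega>)"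
proof -
  \<comment> \<open>Writing the vector as a combination of axis vectors makes its continuity a
    matter of sums and scalar multiples.\<close>
  define f :: "real \<times> real \<times> real \<Rightarrow> real^3" where
    "f v = (fst v / real n) *\<^sub>R axis 1 1 + (fst (snd v) / real n) *\<^sub>R axis 2 1
      + (snd (snd v) / real n) *\<^sub>R axis 3 1" for v
  have real: "cadlag (\<lambda>t. real (x t))" if "cadlag x" for x :: "real \<Rightarrow> nat"
    using that by (rule cadlag_compose) simp
  have "cadlag (\<lambda>t. f (real (ZQ t \<omega>), real (ZRD t \<omega>), real (ZRC t \<omega>)))"
  proof (rule cadlag_compose[where f = f])
    show "cadlag (\<lambda>t. (real (ZQ t \<omega>), real (ZRD t \<omega>), real (ZRC t \<omega>)))"
      by (intro cadlag_Pair real paths assms)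
    show "continuous_on UNIV f" unfolding f_def divide_inverse by (intro continuous_intros)
  qed
  also have "(\<lambda>t. f (real (ZQ t \<omega>), real (ZRD t \<omega>), real (ZRC t \<omega>))) = (\<lambda>t. fluid_scaled n ZQ ZRD ZRC t \<omega>)"
    by (auto simp: fun_eq_iff vec_eq_iff forall_3 f_def axis_def)
  finally show ?thesis .
qed

text \<open>The scaled states are images of triples of natural numbers, which provides the countable
  set of values that \<open>measurable_J1\<close> asks for.\<close>

lemma (in call_center_model) measurable_fluid_scaled_J1:
  "(\<lambda>\<omega>. \<lambda>t\<in>{0..}. fluid_scaled n ZQ ZRD ZRC t \<omega>) \<in> measurable M (borel_of J1_topology)"
proof (rule measurable_J1)
  define f :: "nat \<times> nat \<times> nat \<Rightarrow> real^3" where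
    "f = (\<lambda>(a, b, c). vector [real a / real n, real b / real n, real c / real n])"
  show "countable (range f)" by simp
  show "(\<lambda>\<omega>. (\<lambda>t\<in>{0..}. fluid_scaled n ZQ ZRD ZRC t \<omega>) t) \<in> measurable M (count_space (range f))"
    if t: "t \<ge> 0" for t
  proof -
    have "(\<lambda>\<omega>. (ZQ t \<omega>, ZRD t \<omega>, ZRC t \<omega>)) \<in> measurable M
        (count_space UNIV \<Otimes>\<^sub>M (count_space UNIV \<Otimes>\<^sub>M count_space UNIV))"
      by (intro measurable_Pair random_variables t)
    hence "(\<lambda>\<omega>. (ZQ t \<omega>, ZRD t \<omega>, ZRC t \<omega>)) \<in> measurable M (count_space UNIV)"
      by (simp add: pair_measure_countable)
    hence "(\<lambda>\<omega>. f (ZQ t \<omega>, ZRD t \<omega>, ZRC t \<omega>)) \<in> measurable M (count_space (range f))"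
      by (rule measurable_compose) auto
    thus ?thesis using t by (simp add: f_def fluid_scaled_def)
  qed
  show "(\<lambda>t\<in>{0..}. fluid_scaled n ZQ ZRD ZRC t \<omega>) \<in> cadlag_paths" if "\<omega> \<in> space M" for \<omega>
  proof -
    have "cadlag (\<lambda>t\<in>{0..}. fluid_scaled n ZQ ZRD ZRC t \<omega>)"
      by (rule cadlag_cong_nonneg[OF cadlag_fluid_scaled[OF that]]) simp
    thus ?thesis by (simp add: cadlag_paths_def)
  qed
qed

section \<open>Pathwise comparison with the fluid solution\<close>

locale call_center_fluid = call_center_model + fluid_parameters
begin

text \<open>\<open>C\<close> bounds the scaled arguments of the four unit rate processes on \<open>[0,T]\<close>: only fresh calls
  increase the total number of customers, so the scaled total is at most
  \<open>3 * (norm z\<^sub>0 + 1) + lam * T + 1\<close>. Of the error \<open>12 * e\<close>, one \<open>e\<close> stems from the initial state, five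
  from the queue, and three from each orbit, where thinning costs two.\<close>

lemma fluid_residual:
  fixes z\<^sub>0 :: "real^3"
  assumes n: "n > 0" and \<omega>: "\<omega> \<in> space M"
    and dyn: "\<forall>t\<ge>0.
        real (ZQ t \<omega>) = real (ZQ 0 \<omega>) + real (P\<^sub>0 t \<omega>) + real (DRD t \<omega>) + real (DRC t \<omega>)
          - real (Ds t \<omega>) - real (Da t \<omega>) \<and>
        real (ZRD t \<omega>) = real (ZRD 0 \<omega>) + (\<Sum>j=1..Da t \<omega>. of_bool (Bp j \<omega>)) - real (DRD t \<omega>) \<and>
        real (ZRC t \<omega>) = real (ZRC 0 \<omega>) + (\<Sum>j=1..Ds t \<omega>. of_bool (Bq j \<omega>)) - real (DRC t \<omega>)"
    and e: "0 < e" "e \<le> 1" and T: "T \<ge> 0"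
    and C: "C = (mu + theta + dRD + dRC) * (T * (3 * (norm z\<^sub>0 + 1) + lam * T + 1))"
    and init: "norm (fluid_scaled n ZQ ZRD ZRC 0 \<omega> - z\<^sub>0) \<le> e"
    and P0: "\<forall>t\<in>{0..T}. \<bar>real (P\<^sub>0 t \<omega>) - lam * real n * t\<bar> \<le> e * real n"
    and P1: "\<forall>t\<in>{0..C * real n}. \<bar>real (P\<^sub>1 t \<omega>) - 1 * t\<bar> \<le> e * real n"
    and P2: "\<forall>t\<in>{0..C * real n}. \<bar>real (P\<^sub>2 t \<omega>) - 1 * t\<bar> \<le> e * real n"
    and P3: "\<forall>t\<in>{0..C * real n}. \<bar>real (P\<^sub>3 t \<omega>) - 1 * t\<bar> \<le> e * real n"
    and P4: "\<forall>t\<in>{0..C * real n}. \<bar>real (P\<^sub>4 t \<omega>) - 1 * t\<bar> \<le> e * real n"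
    and Bp: "\<forall>k. real k \<le> (C + 1) * real n \<longrightarrow>
      \<bar>(\<Sum>j=1..k. of_bool (Bp j \<omega>)) - p * real k\<bar> \<le> e * real n"
    and Bq: "\<forall>k. real k \<le> (C + 1) * real n \<longrightarrow>
      \<bar>(\<Sum>j=1..k. of_bool (Bq j \<omega>)) - q * real k\<bar> \<le> e * real n"
    and t: "t \<in> {0..T}"
  defines "Z \<equiv> \<lambda>u. fluid_scaled n ZQ ZRD ZRC u \<omega>"
  shows "norm (Z t - z\<^sub>0 - integral {0..t} (\<lambda>u. drift (Z u))) \<le> 12 * e"
proof -
  define K where "K = 3 * (norm z\<^sub>0 + 1) + lam * T + 1"
  have K: "K \<ge> 0" using pos T by (simp add: K_def)
  have n': "real n > 0" using n by simp
  have cadlag_Z: "cadlag Z"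
    unfolding Z_def by (rule cadlag_fluid_scaled[OF \<omega>])
  have Znth: "Z u $ 1 = real (ZQ u \<omega>) / real n" "Z u $ 2 = real (ZRD u \<omega>) / real n"
    "Z u $ 3 = real (ZRC u \<omega>) / real n" for u
    by (simp_all add: Z_def)
  have dyn1: "real (ZQ u \<omega>) = real (ZQ 0 \<omega>) + real (P\<^sub>0 u \<omega>) + real (DRD u \<omega>) + real (DRC u \<omega>)
          - real (Ds u \<omega>) - real (Da u \<omega>)"
    and dyn2: "real (ZRD u \<omega>) = real (ZRD 0 \<omega>) + (\<Sum>j=1..Da u \<omega>. of_bool (Bp j \<omega>)) - real (DRD u \<omega>)"
    and dyn3: "real (ZRC u \<omega>) = real (ZRC 0 \<omega>) + (\<Sum>j=1..Ds u \<omega>. of_bool (Bq j \<omega>)) - real (DRC u \<omega>)"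
    if "u \<ge> 0" for u
    using dyn that by blast+
  have sum_le: "(\<Sum>j=1..k. of_bool (B j \<omega>)) \<le> real k" for B :: "nat \<Rightarrow> 'a \<Rightarrow> bool" and k
    using sum_bounded_above[of "{1..k}" "\<lambda>j. of_bool (B j \<omega>) :: real" 1] by simp
  \<comment> \<open>Adding the three equations cancels \<open>DRD\<close> and \<open>DRC\<close>,
    and by \<open>sum_le\<close> the entries into the orbits do not exceed the departures
    \<open>Da\<close> and \<open>Ds\<close>.\<close>
  have total: "Z u $ 1 + Z u $ 2 + Z u $ 3 \<le> K" if u: "u \<in> {0..T}" for u
  proof -
    have "Z 0 $ i \<le> norm z\<^sub>0 + 1" for i
      using component_le_norm_cart[of "Z 0" i] norm_triangle_sub[of "Z 0" z\<^sub>0] init e by (simp add: Z_def)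
    from this[of 1] this[of 2] this[of 3] have "Z 0 $ 1 + Z 0 $ 2 + Z 0 $ 3 \<le> 3 * (norm z\<^sub>0 + 1)"
      by simp
    hence 0: "real (ZQ 0 \<omega>) + real (ZRD 0 \<omega>) + real (ZRC 0 \<omega>) \<le> 3 * (norm z\<^sub>0 + 1) * real n"
      using n' by (simp add: Znth divide_le_eq flip: add_divide_distrib)
    have "\<bar>real (P\<^sub>0 u \<omega>) - lam * real n * u\<bar> \<le> e * real n" using P0 u by blast
    hence "real (P\<^sub>0 u \<omega>) \<le> lam * real n * u + e * real n" by linarith
    also have "\<dots> \<le> lam * real n * T + 1 * real n"
      using u pos e by (intro add_mono mult_left_mono mult_right_mono) auto
    finally have "real (ZQ u \<omega>) + real (ZRD u \<omega>) + real (ZRC u \<omega>) \<le> 3 * (norm z\<^sub>0 + 1) * real n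
        + lam * real n * T + real n"
      using dyn1[of u] dyn2[of u] dyn3[of u] u 0 sum_le[of Bp "Da u \<omega>"] sum_le[of Bq "Ds u \<omega>"]
      unfolding atLeastAtMost_iff by linarith
    also have "\<dots> = K * real n" by (simp add: K_def algebra_simps)
    finally show ?thesis using n' by (simp add: Znth divide_le_eq flip: add_divide_distrib)
  qed
  have Z0: "0 \<le> Z u $ 1" "0 \<le> Z u $ 2" "0 \<le> Z u $ 3" for u
    by (simp_all add: Znth)
  define J where "J f t = integral {0..t} (\<lambda>u. f (Z u) :: real)" for f t
  define f1 f2 f3 f4 :: "real^3 \<Rightarrow> real" where "f1 v = min (real s) (v $ 1)"
    and "f2 v = max (v $ 1 - real s) 0" and "f3 v = v $ 2" and "f4 v = v $ 3" for v
  have cont: "continuous_on UNIV f1" "continuous_on UNIV f2" "continuous_on UNIV f3" "continuous_on UNIV f4"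
    unfolding f1_def f2_def f3_def f4_def by (intro continuous_intros)+
  have fK: "0 \<le> f1 (Z u)" "0 \<le> f2 (Z u)" "0 \<le> f3 (Z u)" "0 \<le> f4 (Z u)"
    "u \<in> {0..T} \<Longrightarrow> f1 (Z u) \<le> K" "u \<in> {0..T} \<Longrightarrow> f2 (Z u) \<le> K"
    "u \<in> {0..T} \<Longrightarrow> f3 (Z u) \<le> K" "u \<in> {0..T} \<Longrightarrow> f4 (Z u) \<le> K" for u
    using total[of u] Z0[of u] K by (auto simp: f1_def f2_def f3_def f4_def)
  have J: "0 \<le> J f t" "J f t \<le> T * K"
    if "continuous_on UNIV f" "\<And>u. 0 \<le> f (Z u)" "\<And>u. u \<in> {0..T} \<Longrightarrow> f (Z u) \<le> K" for f
  proof -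
    have int: "(\<lambda>u. f (Z u)) integrable_on {0..t}"
      by (rule cadlag_integrable[OF cadlag_compose[OF cadlag_Z that(1)]])
    show "0 \<le> J f t" unfolding J_def by (rule Henstock_Kurzweil_Integration.integral_nonneg[OF int that(2)])
    have "J f t \<le> integral {0..t} (\<lambda>u. K)" unfolding J_def
      using t by (intro Henstock_Kurzweil_Integration.integral_le int that(3)) auto
    also have "\<dots> = t * K" using t by simp
    also have "\<dots> \<le> T * K" using t K by (intro mult_right_mono) auto
    finally show "J f t \<le> T * K" .
  qed
  \<comment> \<open>\<open>C\<close> contains the sum of the four rates, so that one interval serves
    all four clocks.\<close>
  have arg: "real n * (k * J f t) \<in> {0..C * real n}"
    if "0 \<le> k" "k \<le> mu + theta + dRD + dRC" "0 \<le> J f t" "J f t \<le> T * K" for k f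
  proof -
    have "k * J f t \<le> C" unfolding C K_def[symmetric] using that pos by (intro mult_mono) auto
    thus ?thesis using that n' by simp
  qed
  note J1 = J[OF cont(1) fK(1,5)] and J2 = J[OF cont(2) fK(2,6)]
    and J3 = J[OF cont(3) fK(3,7)] and J4 = J[OF cont(4) fK(4,8)]
  have D1: "\<bar>real (Ds t \<omega>) - real n * (mu * J f1 t)\<bar> \<le> e * real n"
  proof -
    \<comment> \<open>Positive homogeneity of \<open>min\<close> pulls out the factor
      \<open>n\<close>; this is where scaling the number of agents along with the arrivals
      enters.\<close>
    have "mu * min (real (n * s)) (real (ZQ u \<omega>)) = real n * mu * f1 (Z u)" for u
      using n' min_mult_distrib_left[of "real n" "real s" "Z u $ 1"] by (simp add: f1_def Znth)
    hence "Ds t \<omega> = P\<^sub>1 (real n * (mu * J f1 t)) \<omega>"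
      by (simp only: Ds_def J_def mult.assoc Henstock_Kurzweil_Integration.integral_mult_right)
    thus ?thesis using P1 arg[OF _ _ J1, of mu] pos by simp
  qed
  have D2: "\<bar>real (Da t \<omega>) - real n * (theta * J f2 t)\<bar> \<le> e * real n"
  proof -
    have "theta * max (real (ZQ u \<omega>) - real (n * s)) 0 = real n * theta * f2 (Z u)" for u
      using n' max_mult_distrib_left[of "real n" "Z u $ 1 - real s" 0]
      by (simp add: f2_def Znth right_diff_distrib)
    hence "Da t \<omega> = P\<^sub>2 (real n * (theta * J f2 t)) \<omega>"
      by (simp only: Da_def J_def mult.assoc Henstock_Kurzweil_Integration.integral_mult_right)
    thus ?thesis using P2 arg[OF _ _ J2, of theta] pos by simp
  qed
  have D3: "\<bar>real (DRD t \<omega>) - real n * (dRD * J f3 t)\<bar> \<le> e * real n"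
  proof -
    have "dRD * real (ZRD u \<omega>) = real n * dRD * f3 (Z u)" for u
      using n' by (simp add: f3_def Znth)
    hence "DRD t \<omega> = P\<^sub>3 (real n * (dRD * J f3 t)) \<omega>"
      by (simp only: DRD_def J_def mult.assoc Henstock_Kurzweil_Integration.integral_mult_right)
    thus ?thesis using P3 arg[OF _ _ J3, of dRD] pos by simp
  qed
  have D4: "\<bar>real (DRC t \<omega>) - real n * (dRC * J f4 t)\<bar> \<le> e * real n"
  proof -
    have "dRC * real (ZRC u \<omega>) = real n * dRC * f4 (Z u)" for u
      using n' by (simp add: f4_def Znth)
    hence "DRC t \<omega> = P\<^sub>4 (real n * (dRC * J f4 t)) \<omega>"
      by (simp only: DRC_def J_def mult.assoc Henstock_Kurzweil_Integration.integral_mult_right)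
    thus ?thesis using P4 arg[OF _ _ J4, of dRC] pos by simp
  qed
  \<comment> \<open>One error comes from the Bernoulli sum at the actual count \<open>k\<close>, the
    other from the count itself, multiplied by \<open>r \<le> 1\<close>. The range
    \<open>(C + 1) * n\<close> covers the mean, at most \<open>C * n\<close>, plus the deviation
    \<open>e * n \<le> n\<close> of the count.\<close>
  have thin: "\<bar>(\<Sum>j=1..k. of_bool (B j \<omega>)) - real n * (r * (a * J f t))\<bar> \<le> 2 * (e * real n)"
    if B: "\<forall>k. real k \<le> (C + 1) * real n \<longrightarrow>
        \<bar>(\<Sum>j=1..k. of_bool (B j \<omega>)) - r * real k\<bar> \<le> e * real n"
      and r: "r \<in> {0..1}" and k: "\<bar>real k - real n * (a * J f t)\<bar> \<le> e * real n"
      and a: "real n * (a * J f t) \<in> {0..C * real n}" for B r k a f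
  proof -
    have "e * real n \<le> 1 * real n" using e by (intro mult_right_mono) auto
    hence "real k \<le> (C + 1) * real n" using k a by (simp add: abs_le_iff algebra_simps)
    hence 1: "\<bar>(\<Sum>j=1..k. of_bool (B j \<omega>)) - r * real k\<bar> \<le> e * real n" using B by blast
    have "\<bar>r * real k - real n * (r * (a * J f t))\<bar> = r * \<bar>real k - real n * (a * J f t)\<bar>"
    proof -
      have "r * real k - real n * (r * (a * J f t)) = r * (real k - real n * (a * J f t))"
        by (simp add: algebra_simps)
      thus ?thesis using r by (simp add: abs_mult)
    qed
    also have "\<dots> \<le> 1 * (e * real n)" using r k by (intro mult_mono) auto
    finally show ?thesis using 1 by linarith
  qed
  have S1: "\<bar>(\<Sum>j=1..Da t \<omega>. of_bool (Bp j \<omega>)) - real n * (p * (theta * J f2 t))\<bar> \<le> 2 * (e * real n)"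
    using pos by (intro thin Bp routing D2 arg J2) auto
  have S2: "\<bar>(\<Sum>j=1..Ds t \<omega>. of_bool (Bq j \<omega>)) - real n * (q * (mu * J f1 t))\<bar> \<le> 2 * (e * real n)"
    using pos by (intro thin Bq routing D1 arg J1) auto
  define R where "R = Z t - Z 0 - integral {0..t} (\<lambda>u. drift (Z u))"
  have t0: "t \<ge> 0" using t by simp
  have I: "integral {0..t} (\<lambda>u. drift (Z u)) $ 1
      = lam * t + dRD * J f3 t + dRC * J f4 t - mu * J f1 t - theta * J f2 t"
    "integral {0..t} (\<lambda>u. drift (Z u)) $ 2 = p * theta * J f2 t - dRD * J f3 t"
    "integral {0..t} (\<lambda>u. drift (Z u)) $ 3 = q * mu * J f1 t - dRC * J f4 t"
    using integral_drift[OF cadlag_Z t0] by (simp_all add: J_def f1_def f2_def f3_def f4_def)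
  have P0t: "\<bar>real (P\<^sub>0 t \<omega>) - lam * real n * t\<bar> \<le> e * real n" using P0 t by blast
  have scale: "\<bar>x\<bar> \<le> y" if "\<bar>x * real n\<bar> \<le> y * real n" for x y
    using that n' by (simp add: abs_mult)
  have nZ: "real n * (Z u $ 1) = real (ZQ u \<omega>)" "real n * (Z u $ 2) = real (ZRD u \<omega>)"
    "real n * (Z u $ 3) = real (ZRC u \<omega>)" for u
    using n' by (simp_all add: Znth)
  have "\<bar>R $ 1\<bar> \<le> 5 * e"
  proof (rule scale)
    have "R $ 1 * real n = real n * (Z t $ 1) - real n * (Z 0 $ 1)
        - real n * (integral {0..t} (\<lambda>u. drift (Z u)) $ 1)"
      by (simp add: R_def algebra_simps)
    also have "\<dots> = (real (P\<^sub>0 t \<omega>) - lam * real n * t) + (real (DRD t \<omega>) - real n * (dRD * J f3 t))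
        + (real (DRC t \<omega>) - real n * (dRC * J f4 t)) - (real (Ds t \<omega>) - real n * (mu * J f1 t))
        - (real (Da t \<omega>) - real n * (theta * J f2 t))"
      using dyn1[OF t0] unfolding nZ I by (simp only: algebra_simps)
    also have "\<bar>\<dots>\<bar> \<le> 5 * e * real n" using P0t D1 D2 D3 D4 by linarith
    finally show "\<bar>R $ 1 * real n\<bar> \<le> 5 * e * real n" .
  qed
  moreover have "\<bar>R $ 2\<bar> \<le> 3 * e"
  proof (rule scale)
    have "R $ 2 * real n = real n * (Z t $ 2) - real n * (Z 0 $ 2)
        - real n * (integral {0..t} (\<lambda>u. drift (Z u)) $ 2)"
      by (simp add: R_def algebra_simps)
    also have "\<dots> = ((\<Sum>j=1..Da t \<omega>. of_bool (Bp j \<omega>)) - real n * (p * (theta * J f2 t)))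
        - (real (DRD t \<omega>) - real n * (dRD * J f3 t))"
      using dyn2[OF t0] unfolding nZ I by (simp only: algebra_simps)
    also have "\<bar>\<dots>\<bar> \<le> 3 * e * real n" using S1 D3 by linarith
    finally show "\<bar>R $ 2 * real n\<bar> \<le> 3 * e * real n" .
  qed
  moreover have "\<bar>R $ 3\<bar> \<le> 3 * e"
  proof (rule scale)
    have "R $ 3 * real n = real n * (Z t $ 3) - real n * (Z 0 $ 3)
        - real n * (integral {0..t} (\<lambda>u. drift (Z u)) $ 3)"
      by (simp add: R_def algebra_simps)
    also have "\<dots> = ((\<Sum>j=1..Ds t \<omega>. of_bool (Bq j \<omega>)) - real n * (q * (mu * J f1 t)))
        - (real (DRC t \<omega>) - real n * (dRC * J f4 t))"
      using dyn3[OF t0] unfolding nZ I by (simp only: algebra_simps)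
    also have "\<bar>\<dots>\<bar> \<le> 3 * e * real n" using S2 D4 by linarith
    finally show "\<bar>R $ 3 * real n\<bar> \<le> 3 * e * real n" .
  qed
  ultimately have R: "norm R \<le> 11 * e"
    using norm_le_l1_cart[of R] by (simp add: sum_3)
  have "Z t - z\<^sub>0 - integral {0..t} (\<lambda>u. drift (Z u)) = R + (Z 0 - z\<^sub>0)" by (simp add: R_def)
  moreover have "norm (Z 0 - z\<^sub>0) \<le> e" using init by (simp add: Z_def)
  hence "norm (R + (Z 0 - z\<^sub>0)) \<le> 12 * e"
    using R norm_triangle_ineq[of R "Z 0 - z\<^sub>0"] by linarith
  ultimately show "norm (Z t - z\<^sub>0 - integral {0..t} (\<lambda>u. drift (Z u))) \<le> 12 * e"
    by (simp only:)
qed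

text \<open>The solution has residual zero, so the bound on the residual of the scaled path is
  exactly the premise of \<open>integral_equation_stability\<close>. The good events form the
  hypothesis of an almost sure implication, ready for \<open>whp_mono\<close>.\<close>

lemma AE_fluid_deviation:
  fixes z\<^sub>0 :: "real^3"
  assumes n: "n > 0"
    and z: "fluid_solution lam mu theta dRD dRC p q s z\<^sub>0 z"
    and e: "0 < e" "e \<le> 1" and T: "T \<ge> 0"
    and C: "C = (mu + theta + dRD + dRC) * (T * (3 * (norm z\<^sub>0 + 1) + lam * T + 1))"
  shows "AE \<omega> in M. norm (fluid_scaled n ZQ ZRD ZRC 0 \<omega> - z\<^sub>0) \<le> e \<and>
      (\<forall>t\<in>{0..T}. \<bar>real (P\<^sub>0 t \<omega>) - lam * real n * t\<bar> \<le> e * real n) \<and>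
      (\<forall>t\<in>{0..C * real n}. \<bar>real (P\<^sub>1 t \<omega>) - 1 * t\<bar> \<le> e * real n) \<and>
      (\<forall>t\<in>{0..C * real n}. \<bar>real (P\<^sub>2 t \<omega>) - 1 * t\<bar> \<le> e * real n) \<and>
      (\<forall>t\<in>{0..C * real n}. \<bar>real (P\<^sub>3 t \<omega>) - 1 * t\<bar> \<le> e * real n) \<and>
      (\<forall>t\<in>{0..C * real n}. \<bar>real (P\<^sub>4 t \<omega>) - 1 * t\<bar> \<le> e * real n) \<and>
      (\<forall>k. real k \<le> (C + 1) * real n \<longrightarrow>
        \<bar>(\<Sum>j=1..k. of_bool (Bp j \<omega>)) - p * real k\<bar> \<le> e * real n) \<and>
      (\<forall>k. real k \<le> (C + 1) * real n \<longrightarrow>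
        \<bar>(\<Sum>j=1..k. of_bool (Bq j \<omega>)) - q * real k\<bar> \<le> e * real n) \<longrightarrow>
    (\<forall>t\<in>{0..T}. norm (fluid_scaled n ZQ ZRD ZRC t \<omega> - z t) \<le> 12 * e * exp (drift_lipschitz * T))"
  using dynamics AE_space
proof eventually_elim
  case (elim \<omega>)
  have z': "continuous_on {0..} z" "\<And>t. t \<ge> 0 \<Longrightarrow> z t = z\<^sub>0 + integral {0..t} (\<lambda>u. drift (z u))"
    using z by (simp_all add: fluid_solution_iff)
  show ?case
  proof (intro impI ballI)
    fix t assume hyp: "norm (fluid_scaled n ZQ ZRD ZRC 0 \<omega> - z\<^sub>0) \<le> e \<and>
      (\<forall>t\<in>{0..T}. \<bar>real (P\<^sub>0 t \<omega>) - lam * real n * t\<bar> \<le> e * real n) \<and>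
      (\<forall>t\<in>{0..C * real n}. \<bar>real (P\<^sub>1 t \<omega>) - 1 * t\<bar> \<le> e * real n) \<and>
      (\<forall>t\<in>{0..C * real n}. \<bar>real (P\<^sub>2 t \<omega>) - 1 * t\<bar> \<le> e * real n) \<and>
      (\<forall>t\<in>{0..C * real n}. \<bar>real (P\<^sub>3 t \<omega>) - 1 * t\<bar> \<le> e * real n) \<and>
      (\<forall>t\<in>{0..C * real n}. \<bar>real (P\<^sub>4 t \<omega>) - 1 * t\<bar> \<le> e * real n) \<and>
      (\<forall>k. real k \<le> (C + 1) * real n \<longrightarrow>
        \<bar>(\<Sum>j=1..k. of_bool (Bp j \<omega>)) - p * real k\<bar> \<le> e * real n) \<and>
      (\<forall>k. real k \<le> (C + 1) * real n \<longrightarrow>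
        \<bar>(\<Sum>j=1..k. of_bool (Bq j \<omega>)) - q * real k\<bar> \<le> e * real n)"
      and t: "t \<in> {0..T}"
    have "norm (fluid_scaled n ZQ ZRD ZRC t \<omega> - z t) \<le> 12 * e * exp (drift_lipschitz * t)"
    proof (rule integral_equation_stability[OF drift_lipschitz drift_lipschitz_pos
          cadlag_fluid_scaled[OF elim(2)] continuous_on_cadlag[OF z'(1)] _ t])
      fix r assume r: "r \<in> {0..T}"
      have "norm (fluid_scaled n ZQ ZRD ZRC r \<omega> - z\<^sub>0
          - integral {0..r} (\<lambda>u. drift (fluid_scaled n ZQ ZRD ZRC u \<omega>))) \<le> 12 * e"
        using hyp by (intro fluid_residual[OF n elim(2,1) e T C _ _ _ _ _ _ _ _ r]) blast+
      thus "norm (fluid_scaled n ZQ ZRD ZRC r \<omega> - z r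
          - (integral {0..r} (\<lambda>u. drift (fluid_scaled n ZQ ZRD ZRC u \<omega>))
             - integral {0..r} (\<lambda>u. drift (z u)))) \<le> 12 * e"
        using z'(2)[of r] r by (simp add: algebra_simps)
    qed
    also have "\<dots> \<le> 12 * e * exp (drift_lipschitz * T)"
      using t e drift_lipschitz_pos by simp
    finally show "norm (fluid_scaled n ZQ ZRD ZRC t \<omega> - z t) \<le> 12 * e * exp (drift_lipschitz * T)" .
  qed
qed

end

theorem theorem1:
  fixes lam mu theta dRD dRC p q :: real and s :: nat
    and M :: "nat \<Rightarrow> 'a measure"
    and P\<^sub>0 P\<^sub>1 P\<^sub>2 P\<^sub>3 P\<^sub>4 :: "nat \<Rightarrow> real \<Rightarrow> 'a \<Rightarrow> nat"
    and Bp Bq :: "nat \<Rightarrow> nat \<Rightarrow> 'a \<Rightarrow> bool"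
    and ZQ ZRD ZRC :: "nat \<Rightarrow> real \<Rightarrow> 'a \<Rightarrow> nat"
    and zQ0 zRD0 zRC0 :: real
  assumes "lam > 0" and "mu > 0" and "theta > 0" and "dRD > 0" and "dRC > 0"
    and "p \<in> {0..1}" and "q \<in> {0..1}" and "s > 0"
    and model: "\<And>n. n \<ge> 1 \<Longrightarrow>
      call_center_model (M n) lam mu theta dRD dRC p q s n
        (P\<^sub>0 n) (P\<^sub>1 n) (P\<^sub>2 n) (P\<^sub>3 n) (P\<^sub>4 n) (Bp n) (Bq n) (ZQ n) (ZRD n) (ZRC n)"
    and initial: "converges_in_distribution euclidean M
      (\<lambda>n. fluid_scaled n (ZQ n) (ZRD n) (ZRC n) 0)
      (return (borel_of euclidean) (vector [zQ0, zRD0, zRC0]))"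
  shows "(\<exists>!z. fluid_solution lam mu theta dRD dRC p q s (vector [zQ0, zRD0, zRC0]) z) \<and>
    (\<forall>z. fluid_solution lam mu theta dRD dRC p q s (vector [zQ0, zRD0, zRC0]) z \<longrightarrow>
      converges_in_distribution J1_topology M
        (\<lambda>n \<omega>. \<lambda>t\<in>{0..}. fluid_scaled n (ZQ n) (ZRD n) (ZRC n) t \<omega>)
        (return (borel_of J1_topology) z))"
proof (intro conjI allI impI)
  interpret fluid_parameters lam mu theta dRD dRC p q s
    by unfold_locales fact+
  show "\<exists>!z. fluid_solution lam mu theta dRD dRC p q s (vector [zQ0, zRD0, zRC0]) z"
    using fluid_solution_exists fluid_solution_unique by (rule ex_ex1I)
  fix z assume z: "fluid_solution lam mu theta dRD dRC p q s (vector [zQ0, zRD0, zRC0]) z"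
  define z\<^sub>0 :: "real^3" where "z\<^sub>0 = vector [zQ0, zRD0, zRC0]"
  have fluid: "call_center_fluid (M n) lam mu theta dRD dRC p q s n
        (P\<^sub>0 n) (P\<^sub>1 n) (P\<^sub>2 n) (P\<^sub>3 n) (P\<^sub>4 n) (Bp n) (Bq n) (ZQ n) (ZRD n) (ZRC n)" if "n \<ge> 1" for n
    by (intro call_center_fluid.intro model that fluid_parameters_axioms)
  have M: "prob_space (M n)" if "n \<ge> 1" for n
    using model[OF that] by (simp add: call_center_model_def call_center_data_def)
  show "converges_in_distribution J1_topology M
        (\<lambda>n \<omega>. \<lambda>t\<in>{0..}. fluid_scaled n (ZQ n) (ZRD n) (ZRC n) t \<omega>)
        (return (borel_of J1_topology) z)"
  proof (rule whp_imp_converges_in_distribution_J1[OF M])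
    show "(\<lambda>\<omega>. \<lambda>t\<in>{0..}. fluid_scaled n (ZQ n) (ZRD n) (ZRC n) t \<omega>)
        \<in> measurable (M n) (borel_of J1_topology)" if "n \<ge> 1" for n
      by (rule call_center_model.measurable_fluid_scaled_J1[OF model[OF that]])
    show "z \<in> cadlag_paths"
      using z by (simp add: fluid_solution_iff cadlag_paths_def continuous_on_cadlag)
  next
    fix T d :: real assume T: "T > 0" and d: "d > 0"
    define C where "C = (mu + theta + dRD + dRC) * (T * (3 * (norm z\<^sub>0 + 1) + lam * T + 1))"
    have "3 * (norm z\<^sub>0 + 1) + lam * T + 1 > 0"
      using pos T by (intro add_pos_pos mult_pos_pos add_nonneg_pos) auto
    hence C: "C > 0" unfolding C_def using pos T by (intro mult_pos_pos) auto
    \<comment> \<open>The quotient undoes the factor \<open>12 * exp (drift_lipschitz * T)\<close>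
      lost in the comparison; the cap at \<open>1\<close> is what the a priori bound
      \<open>C\<close> presupposes.\<close>
    define e where "e = min 1 (d / (12 * exp (drift_lipschitz * T)))"
    have e: "0 < e" "e \<le> 1" "e \<le> d / (12 * exp (drift_lipschitz * T))"
      using d by (simp_all add: e_def)
    have unit: "whp M (\<lambda>n \<omega>. \<forall>t\<in>{0..C * real n}. \<bar>real (P n t \<omega>) - 1 * t\<bar> \<le> e * real n)"
      if "\<And>n. n \<ge> 1 \<Longrightarrow> poisson_process (M n) 1 (P n)" for P
      by (rule whp_poisson_process[where c = C]) (use that C e in auto)
    have init: "whp M (\<lambda>n \<omega>. norm (fluid_scaled n (ZQ n) (ZRD n) (ZRC n) 0 \<omega> - z\<^sub>0) \<le> e)"
      using converges_in_distribution_imp_whp[OF initial M e(1)] by (simp add: z\<^sub>0_def)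
    have fresh: "whp M (\<lambda>n \<omega>. \<forall>t\<in>{0..T}. \<bar>real (P\<^sub>0 n t \<omega>) - lam * real n * t\<bar> \<le> e * real n)"
      by (rule whp_poisson_process[where T = "\<lambda>_. T" and c = "lam * T"])
        (use call_center_model.fresh[OF model] pos T e in auto)
    have bern: "whp M (\<lambda>n \<omega>. \<forall>k. real k \<le> (C + 1) * real n \<longrightarrow>
        \<bar>(\<Sum>j=1..k. of_bool (B n j \<omega>)) - r * real k\<bar> \<le> e * real n)"
      if "\<And>n. n \<ge> 1 \<Longrightarrow> iid_bernoulli (M n) r (B n)" "r \<in> {0..1}" for B r
      using C by (intro whp_iid_bernoulli[OF M that _ e(1)]) auto
    show "whp M (\<lambda>n \<omega>. \<forall>t\<in>{0..T}.
        norm ((\<lambda>t\<in>{0..}. fluid_scaled n (ZQ n) (ZRD n) (ZRC n) t \<omega>) t - z t) \<le> d)"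
    proof (rule whp_mono)
      show "whp M (\<lambda>n \<omega>. norm (fluid_scaled n (ZQ n) (ZRD n) (ZRC n) 0 \<omega> - z\<^sub>0) \<le> e \<and>
        (\<forall>t\<in>{0..T}. \<bar>real (P\<^sub>0 n t \<omega>) - lam * real n * t\<bar> \<le> e * real n) \<and>
        (\<forall>t\<in>{0..C * real n}. \<bar>real (P\<^sub>1 n t \<omega>) - 1 * t\<bar> \<le> e * real n) \<and>
        (\<forall>t\<in>{0..C * real n}. \<bar>real (P\<^sub>2 n t \<omega>) - 1 * t\<bar> \<le> e * real n) \<and>
        (\<forall>t\<in>{0..C * real n}. \<bar>real (P\<^sub>3 n t \<omega>) - 1 * t\<bar> \<le> e * real n) \<and>
        (\<forall>t\<in>{0..C * real n}. \<bar>real (P\<^sub>4 n t \<omega>) - 1 * t\<bar> \<le> e * real n) \<and>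
        (\<forall>k. real k \<le> (C + 1) * real n \<longrightarrow>
          \<bar>(\<Sum>j=1..k. of_bool (Bp n j \<omega>)) - p * real k\<bar> \<le> e * real n) \<and>
        (\<forall>k. real k \<le> (C + 1) * real n \<longrightarrow>
          \<bar>(\<Sum>j=1..k. of_bool (Bq n j \<omega>)) - q * real k\<bar> \<le> e * real n))"
        by (intro whp_conj init fresh unit bern routing)
          (rule call_center_model.unit_rate[OF model] call_center_model.bernoulli[OF model]; assumption)+
      show "eventually (\<lambda>n. AE \<omega> in M n. norm (fluid_scaled n (ZQ n) (ZRD n) (ZRC n) 0 \<omega> - z\<^sub>0) \<le> e \<and>
        (\<forall>t\<in>{0..T}. \<bar>real (P\<^sub>0 n t \<omega>) - lam * real n * t\<bar> \<le> e * real n) \<and>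
        (\<forall>t\<in>{0..C * real n}. \<bar>real (P\<^sub>1 n t \<omega>) - 1 * t\<bar> \<le> e * real n) \<and>
        (\<forall>t\<in>{0..C * real n}. \<bar>real (P\<^sub>2 n t \<omega>) - 1 * t\<bar> \<le> e * real n) \<and>
        (\<forall>t\<in>{0..C * real n}. \<bar>real (P\<^sub>3 n t \<omega>) - 1 * t\<bar> \<le> e * real n) \<and>
        (\<forall>t\<in>{0..C * real n}. \<bar>real (P\<^sub>4 n t \<omega>) - 1 * t\<bar> \<le> e * real n) \<and>
        (\<forall>k. real k \<le> (C + 1) * real n \<longrightarrow>
          \<bar>(\<Sum>j=1..k. of_bool (Bp n j \<omega>)) - p * real k\<bar> \<le> e * real n) \<and>
        (\<forall>k. real k \<le> (C + 1) * real n \<longrightarrow>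
          \<bar>(\<Sum>j=1..k. of_bool (Bq n j \<omega>)) - q * real k\<bar> \<le> e * real n) \<longrightarrow>
        (\<forall>t\<in>{0..T}. norm ((\<lambda>t\<in>{0..}. fluid_scaled n (ZQ n) (ZRD n) (ZRC n) t \<omega>) t - z t) \<le> d)) sequentially"
        using eventually_ge_at_top[of 1]
      proof eventually_elim
        case (elim n)
        hence "n > 0" by simp
        have "12 * e * exp (drift_lipschitz * T) \<le> d" using e by (simp add: field_simps)
        hence bound: "\<forall>t\<in>{0..T}. norm ((\<lambda>t\<in>{0..}. fluid_scaled n (ZQ n) (ZRD n) (ZRC n) t \<omega>) t - z t) \<le> d"
          if "\<forall>t\<in>{0..T}. norm (fluid_scaled n (ZQ n) (ZRD n) (ZRC n) t \<omega> - z t)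
            \<le> 12 * e * exp (drift_lipschitz * T)" for \<omega>
          using that by (fastforce intro: order_trans)
        from call_center_fluid.AE_fluid_deviation[OF fluid[OF elim] \<open>n > 0\<close> z[folded z\<^sub>0_def] e(1,2) less_imp_le[OF T] C_def]
        show ?case
          by eventually_elim (use bound in blast)
      qed
    qed
  qed
qed

end
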